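(* Let $\lambda_1,\lambda,\beta>0$, let $N_1$ be a Poisson process with intensity $\lambda_1$, and let $E_N(t)=E(N(t))$, $t\ge 0$, be the compound Poisson-exponential subordinator with parameters $\lambda,\beta$, independent of $N_1$. For an integer $k\ge1$ let $T_k^E=\inf\{s:N_1(E_N(s))=k\}$. Then for every $k\ge1$ $$P\{T_k^E\in ds\}=\frac{\lambda\beta}{\lambda_1+\beta}\sum_{n=0}^{\infty}P\{N_\lambda(s)=n\}\,P\{N_\beta(E_{\lambda_1}(k))=n\}\,ds,\qquad s>0,$$ where $N_\lambda$ is a Poisson process with intensity $\lambda$, and $N_\beta(E_{\lambda_1}(k))$ is the Poisson process $N_\beta$ with intensity $\beta$ evaluated at the independent random time $E_{\lambda_1}(k)$, the value at time $k$ of the exponential process with parameter $\lambda_1$.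
   Context: The exponential process $E_b$ with parameter $b>0$ is the subordinator with $E e^{-uE_b(t)}=(1+u/b)^{-t}$ (the Gamma process with shape parameter $1$ and rate $b$). The compound Poisson-exponential subordinator with parameters $\lambda,\beta$ is $E_N(t)=E_\beta(N(t))$ with $N$ a Poisson process of intensity $\lambda$ independent of $E_\beta$. The convention $\inf\emptyset=\infty$ is used; the formula gives the (possibly defective) density of $T_k^E$ on $(0,\infty)$. *)

theory Defs
  imports "HOL-Probability.Probability"
begin

text \<open>
  Processes are indexed by \<open>real\<close>; only times in \<open>{0..}\<close> are constrained.
\<close>

definition independent_increments :: "'a measure \<Rightarrow> (real \<Rightarrow> 'a \<Rightarrow> real) \<Rightarrow> bool" where
  "independent_increments M X \<longleftrightarrow>
     (\<forall>(t :: nat \<Rightarrow> real) n. 0 \<le> t 0 \<longrightarrow> incseq t \<longrightarrow>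
        prob_space.indep_vars M (\<lambda>_. borel) (\<lambda>i \<omega>. X (t (Suc i)) \<omega> - X (t i) \<omega>) {..<n})"

definition stationary_increments :: "'a measure \<Rightarrow> (real \<Rightarrow> 'a \<Rightarrow> real) \<Rightarrow> bool" where
  "stationary_increments M X \<longleftrightarrow>
     (\<forall>s\<ge>0. \<forall>h\<ge>0. distr M borel (\<lambda>\<omega>. X (s + h) \<omega> - X s \<omega>) = distr M borel (X h))"

text \<open>
  A subordinator is a nondecreasing Levy process. The path properties are required of every
  path, not just almost every one, so that first passage times are measurable without completing
  the space. Left limits exist by monotonicity; stochastic continuity follows from
  right-continuity and stationarity.
\<close>

definition subordinator :: "'a measure \<Rightarrow> (real \<Rightarrow> 'a \<Rightarrow> real) \<Rightarrow> bool" where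
  "subordinator M X \<longleftrightarrow>
     prob_space M \<and>
     (\<forall>t\<ge>0. X t \<in> borel_measurable M) \<and>
     independent_increments M X \<and>
     stationary_increments M X \<and>
     (\<forall>\<omega>\<in>space M. X 0 \<omega> = 0 \<and>
        mono_on {0..} (\<lambda>t. X t \<omega>) \<and>
        (\<forall>t\<ge>0. continuous (at_right t) (\<lambda>s. X s \<omega>)))"

definition poisson_process :: "'a measure \<Rightarrow> real \<Rightarrow> (real \<Rightarrow> 'a \<Rightarrow> nat) \<Rightarrow> bool" where
  "poisson_process M l N \<longleftrightarrow>
     subordinator M (\<lambda>t \<omega>. real (N t \<omega>)) \<and>
     (\<forall>t\<ge>0. \<forall>n. measure M {\<omega> \<in> space M. N t \<omega> = n} = exp (- (l * t)) * (l * t) ^ n / fact n)"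

definition exponential_process :: "'a measure \<Rightarrow> real \<Rightarrow> (real \<Rightarrow> 'a \<Rightarrow> real) \<Rightarrow> bool" where
  "exponential_process M b E \<longleftrightarrow>
     subordinator M E \<and>
     (\<forall>t\<ge>0. \<forall>u\<ge>0. prob_space.expectation M (\<lambda>\<omega>. exp (- (u * E t \<omega>))) = (1 + u / b) powr (- t))"

definition generated_events ::
    "'a measure \<Rightarrow> real set \<Rightarrow> (real \<Rightarrow> 'a \<Rightarrow> 'b::topological_space) \<Rightarrow> 'a set set" where
  "generated_events M I X =
     sigma_sets (space M) {X t -` B \<inter> space M | t B. t \<in> I \<and> B \<in> sets borel}"

definition independent_processes ::
    "'a measure \<Rightarrow> (real \<Rightarrow> 'a \<Rightarrow> 'b::topological_space) \<Rightarrow>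
       (real \<Rightarrow> 'a \<Rightarrow> 'c::topological_space) \<Rightarrow> bool" where
  "independent_processes M X Y \<longleftrightarrow>
     prob_space.indep_set M (generated_events M {0..} X) (generated_events M {0..} Y)"

definition subordinated ::
    "(real \<Rightarrow> 'a \<Rightarrow> 'b) \<Rightarrow> (real \<Rightarrow> 'a \<Rightarrow> real) \<Rightarrow> real \<Rightarrow> 'a \<Rightarrow> 'b" where
  "subordinated X Y t \<omega> = X (Y t \<omega>) \<omega>"

text \<open>In \<open>ereal\<close>, the infimum of the empty set is \<open>\<infinity>\<close>.\<close>

definition hitting_time :: "(real \<Rightarrow> 'a \<Rightarrow> nat) \<Rightarrow> nat \<Rightarrow> 'a \<Rightarrow> ereal" where
  "hitting_time X k \<omega> = Inf (ereal ` {s. 0 \<le> s \<and> X s \<omega> = k})"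

end

theory Submission
  imports Defs
begin


text \<open>
  Write \<open>X s = N1 (E (N s))\<close>. Freeze the path of \<open>N1\<close>, and take \<open>N\<close> and \<open>E\<close> from independent copies
  of the space. Since \<open>N\<close> almost surely has only unit jumps, \<open>X\<close> hits \<open>k\<close> by time \<open>t\<close> iff the
  chain \<open>y n = N1 (E n)\<close> jumps onto \<open>k\<close> at some step \<open>n \<rightarrow> n + 1\<close> with \<open>n < N t\<close>. At most one \<open>n\<close>
  qualifies, so \<open>P (T \<le> t) = (\<Sum>n. P (n < N t) * a n)\<close> with \<open>a n = P (y n < k, y (n + 1) = k)\<close>. As
  \<open>P (n < N t)\<close> is the Erlang distribution function, the law of \<open>T\<close> has the density
  \<open>\<Sum>n. lam * P (N s = n) * a n\<close>. Finally \<open>a n\<close> is a convolution of negative binomial probabilities,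
  which the parallel summation formula identifies with
  \<open>beta / (lam1 + beta) * P (N_beta (E1 k) = n)\<close>.
\<close>

text \<open>\<open>N1\<close> is assumed independent of \<open>EN\<close>, and \<open>N\<close> of
  \<open>E\<close>, so the three processes cannot be separated at once. The event is written through
  \<open>N1\<close> and \<open>EN\<close>, these are decoupled, and only inside the inner integral,
  with the path of \<open>N1\<close> fixed, is \<open>EN\<close> resolved into \<open>N\<close> and
  \<open>E\<close>. Independence is known on generated sigma-algebras, so each event has to be built
  from countably many times; right-continuity of the paths makes this possible. Write p =
  \<open>beta / (lam1 + beta)\<close> and r = 1 - p. The chain has independent geometric steps, of
  size j with probability p r^j. Being at j after n steps and then entering k has weight p^n r^j
  times p r^(k-j), where the power of r no longer depends on j. The p of the last step is the
  constant of the theorem, and p^n r^k is the weight of n Poisson points of rate \<open>beta\<close>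
  in a Gamma time of shape k and rate \<open>lam1\<close>: the two rates have exchanged roles. As
  \<open>X\<close> can jump over k, the density is defective; its total mass is p.\<close>

section \<open>Measurability and independence of processes\<close>

text \<open>A right-continuous path at a random time is the limit of its values at rational times
  above it, and countably valued times preserve measurability. The time lives on \<open>B\<close>
  and the path on \<open>A\<close>, so \<open>B\<close> may be a product with path and time as
  separate coordinates.\<close>

lemma borel_measurable_right_continuous_process:
  fixes X :: "real \<Rightarrow> 'a \<Rightarrow> real"
  assumes X: "\<And>t. 0 \<le> t \<Longrightarrow> X t \<in> borel_measurable A"
    and rc: "\<And>\<omega> t. \<omega> \<in> space A \<Longrightarrow> 0 \<le> t \<Longrightarrow> continuous (at_right t) (\<lambda>s. X s \<omega>)"
    and f: "f \<in> borel_measurable B" "\<And>x. x \<in> space B \<Longrightarrow> 0 \<le> f x"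
    and g: "g \<in> measurable B A"
  shows "(\<lambda>x. X (f x) (g x)) \<in> borel_measurable B"
proof -
  \<comment> \<open>Floor plus one rather than ceiling: \<open>d m x\<close> must lie strictly to
    the right of \<open>f x\<close>.\<close>
  define d where "d m x = (real_of_int \<lfloor>real (Suc m) * f x\<rfloor> + 1) / real (Suc m)" for m x
  have d_gt: "f x < d m x" and d_le: "d m x \<le> f x + inverse (real (Suc m))" for m x
  proof -
    have "real (Suc m) * f x < real_of_int \<lfloor>real (Suc m) * f x\<rfloor> + 1"
      by linarith
    then show "f x < d m x"
      by (simp add: d_def pos_less_divide_eq mult.commute del: of_nat_Suc)
    have "real_of_int \<lfloor>real (Suc m) * f x\<rfloor> + 1 \<le> real (Suc m) * f x + 1"
      by linarith
    then have "d m x \<le> (real (Suc m) * f x + 1) / real (Suc m)"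
      unfolding d_def by (intro divide_right_mono) auto
    also have "\<dots> = f x + inverse (real (Suc m))"
      by (simp add: add_divide_distrib inverse_eq_divide del: of_nat_Suc)
    finally show "d m x \<le> f x + inverse (real (Suc m))" .
  qed
  have lim: "(\<lambda>m. X (d m x) (g x)) \<longlonglongrightarrow> X (f x) (g x)" if x: "x \<in> space B" for x
  proof -
    have "(\<lambda>m. d m x) \<longlonglongrightarrow> f x"
    proof (rule real_tendsto_sandwich[where f="\<lambda>_. f x" and h="\<lambda>m. f x + inverse (real (Suc m))"])
      show "(\<lambda>m. f x + inverse (real (Suc m))) \<longlonglongrightarrow> f x"
        using tendsto_add[OF tendsto_const LIMSEQ_inverse_real_of_nat] by simp
    qed (auto intro!: always_eventually less_imp_le[OF d_gt] d_le simp del: of_nat_Suc)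
    then have "filterlim (\<lambda>m. d m x) (at_right (f x)) sequentially"
      unfolding at_within_def filterlim_inf filterlim_principal
      using d_gt less_imp_neq[OF d_gt] by (auto intro!: always_eventually)
    moreover have "((\<lambda>s. X s (g x)) \<longlongrightarrow> X (f x) (g x)) (at_right (f x))"
      using rc[OF measurable_space[OF g x] f(2)[OF x]] by (simp add: continuous_within)
    ultimately show ?thesis
      by (rule filterlim_compose[rotated])
  qed
  show ?thesis
  proof (rule borel_measurable_LIMSEQ_real[OF lim])
    fix m
    \<comment> \<open>The index \<open>i\<close> runs over all integers, while \<open>X\<close> is
      known to be measurable at nonnegative times; \<open>max 0\<close> does not change
      \<open>d m x\<close>, which exceeds \<open>f x\<close>.\<close>
    have "(\<lambda>x. X (max 0 ((real_of_int i + 1) / real (Suc m))) (g x)) \<in> borel_measurable B" for i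
      by (rule measurable_compose[OF g X]) simp
    moreover have "(\<lambda>x. \<lfloor>real (Suc m) * f x\<rfloor>) \<in> measurable B (count_space UNIV)"
      using f(1) by measurable
    ultimately have "(\<lambda>x. X (max 0 (d m x)) (g x)) \<in> borel_measurable B"
      unfolding d_def by (rule measurable_compose_countable)
    then show "(\<lambda>x. X (d m x) (g x)) \<in> borel_measurable B"
      by (rule measurable_cong[THEN iffD1, rotated])
        (use f(2) d_gt in \<open>auto simp: max_def not_le dest: less_imp_le order.strict_trans1\<close>)
  qed
qed

text \<open>This serves as a sigma-algebra in products, while integrals are taken over
  \<open>M\<close>. A general index set is kept because \<open>E1\<close> is assumed independent of
  \<open>N_beta\<close> at the single time \<open>k\<close>.\<close>

definition generated_algebra :: "'a measure \<Rightarrow> real set \<Rightarrow> (real \<Rightarrow> 'a \<Rightarrow> 'b::topological_space) \<Rightarrow> 'a measure" where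
  "generated_algebra M I X = sigma (space M) (generated_events M I X)"

lemma space_generated_algebra [simp]: "space (generated_algebra M I X) = space M"
  by (simp add: generated_algebra_def space_measure_of_conv)

lemma generated_events_sigma_algebra:
  "sigma_algebra (space M) (generated_events M I X)"
  unfolding generated_events_def by (rule sigma_algebra_sigma_sets) auto

lemma sets_generated_algebra [simp]: "sets (generated_algebra M I X) = generated_events M I X"
proof -
  interpret sigma_algebra "space M" "generated_events M I X"
    by (rule generated_events_sigma_algebra)
  show ?thesis
    by (simp add: generated_algebra_def sets_measure_of[OF space_closed] sigma_sets_eq)
qed

lemma measurable_generated_algebra:
  "t \<in> I \<Longrightarrow> X t \<in> borel_measurable (generated_algebra M I X)"
  by (rule measurableI) (auto simp: generated_events_def)

lemma indep_set_commute_prob: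
  assumes "prob_space M" "prob_space.indep_set M A B"
  shows "prob_space.indep_set M B A"
proof -
  interpret prob_space M by fact
  show ?thesis
    using assms(2) unfolding indep_sets2_eq by (metis Int_commute mult.commute)
qed

text \<open>Both coordinates of the diagonal map on \<open>\<Omega>\<close> are the identity, but the two copies of \<open>\<Omega>\<close> carry
  different \<open>\<sigma>\<close>-algebras; independence says that this map has a product law.\<close>
lemma nn_integral_independent:
  assumes "prob_space M" and ind: "prob_space.indep_set M (generated_events M I X) (generated_events M J Y)"
    and h: "h \<in> borel_measurable (generated_algebra M I X \<Otimes>\<^sub>M generated_algebra M J Y)"
  shows "(\<integral>\<^sup>+ \<omega>. h (\<omega>, \<omega>) \<partial>M) = (\<integral>\<^sup>+ a. \<integral>\<^sup>+ b. h (a, b) \<partial>M \<partial>M)"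
proof -
  interpret prob_space M by fact
  let ?A = "generated_algebra M I X" and ?B = "generated_algebra M J Y"
  have sub: "generated_events M I X \<subseteq> events" "generated_events M J Y \<subseteq> events"
    using ind by (auto simp: indep_sets2_eq)
  have mA: "(\<lambda>\<omega>. \<omega>) \<in> measurable M ?A" and mB: "(\<lambda>\<omega>. \<omega>) \<in> measurable M ?B"
    using sub by (auto intro!: measurableI simp: Int_absorb2 dest: sets.sets_into_space)
  \<comment> \<open>\<open>indep_var_eq\<close> speaks of preimages under the identity; these must
    be recognised as the events themselves.\<close>
  have vimage: "{(\<lambda>\<omega>. \<omega>) -` C \<inter> space M |C. C \<in> \<C>} = \<C>" if "\<C> \<subseteq> events" for \<C>
  proof -
    have "(\<lambda>\<omega>. \<omega>) -` C \<inter> space M = C" if "C \<in> \<C>" for C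
      using that \<open>\<C> \<subseteq> events\<close> sets.sets_into_space by auto
    then show ?thesis
      unfolding Setcompr_eq_image by simp
  qed
  have "sigma_sets (space M) (generated_events M I X) = generated_events M I X"
     "sigma_sets (space M) (generated_events M J Y) = generated_events M J Y"
    using generated_events_sigma_algebra by (auto intro!: sigma_algebra.sigma_sets_eq)
  then have "indep_var ?A (\<lambda>\<omega>. \<omega>) ?B (\<lambda>\<omega>. \<omega>)"
    using ind mA mB unfolding indep_var_eq sets_generated_algebra sub[THEN vimage] by simp
  then have eq: "distr M (?A \<Otimes>\<^sub>M ?B) (\<lambda>\<omega>. (\<omega>, \<omega>)) = distr M ?A (\<lambda>\<omega>. \<omega>) \<Otimes>\<^sub>M distr M ?B (\<lambda>\<omega>. \<omega>)"
    by (simp add: indep_var_distribution_eq)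
  have h': "h \<in> borel_measurable (distr M ?A (\<lambda>\<omega>. \<omega>) \<Otimes>\<^sub>M distr M ?B (\<lambda>\<omega>. \<omega>))"
    using h by (rule measurable_cong_sets[THEN equalityD2, THEN subsetD, rotated 2])
      (auto intro!: sets_pair_measure_cong)
  interpret B: prob_space "distr M ?B (\<lambda>\<omega>. \<omega>)"
    by (rule prob_space_distr[OF mB])
  have "(\<integral>\<^sup>+ \<omega>. h (\<omega>, \<omega>) \<partial>M) = (\<integral>\<^sup>+ x. h x \<partial>distr M (?A \<Otimes>\<^sub>M ?B) (\<lambda>\<omega>. (\<omega>, \<omega>)))"
    using h mA mB by (simp add: nn_integral_distr)
  also have "\<dots> = (\<integral>\<^sup>+ a. \<integral>\<^sup>+ b. h (a, b) \<partial>distr M ?B (\<lambda>\<omega>. \<omega>) \<partial>distr M ?A (\<lambda>\<omega>. \<omega>))"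
    unfolding eq by (rule B.nn_integral_fst[OF h', symmetric])
  also have "\<dots> = (\<integral>\<^sup>+ a. \<integral>\<^sup>+ b. h (a, b) \<partial>M \<partial>M)"
  proof -
    have "(\<lambda>a. \<integral>\<^sup>+ b. h (a, b) \<partial>distr M ?B (\<lambda>\<omega>. \<omega>)) \<in> borel_measurable ?A"
      using B.borel_measurable_nn_integral_fst[OF h'] by simp
    moreover have "(\<integral>\<^sup>+ b. h (a, b) \<partial>distr M ?B (\<lambda>\<omega>. \<omega>)) = (\<integral>\<^sup>+ b. h (a, b) \<partial>M)" if "a \<in> space M" for a
      using that h mB by (subst nn_integral_distr) auto
    ultimately show ?thesis
      using mA by (subst nn_integral_distr) (auto intro!: nn_integral_cong)
  qed
  finally show ?thesis .
qed


section \<open>Increments and Poisson mixtures\<close>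

text \<open>Once the lower coefficients vanish, division by \<open>z ^ m\<close> leaves a series
  that sums to 0 off the origin and tends to \<open>d m\<close> at the origin.\<close>

lemma power_series_zero_coeff:
  fixes d :: "nat \<Rightarrow> real"
  assumes "0 < r" and sums: "\<And>z. z \<noteq> 0 \<Longrightarrow> norm z < r \<Longrightarrow> (\<lambda>n. d n * z ^ n) sums 0"
  shows "d m = 0"
proof (induction m rule: less_induct)
  case (less m)
  have "(\<lambda>n. d (n + m) * z ^ n) sums 0" if z: "z \<noteq> 0" "norm z < r" for z
  proof -
    have "(\<lambda>n. d (n + m) * z ^ (n + m)) sums 0"
      using sums[OF z] less by (subst sums_iff_shift) auto
    then have "(\<lambda>n. d (n + m) * z ^ (n + m) / z ^ m) sums (0 / z ^ m)"
      by (rule sums_divide)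
    then show ?thesis
      using z by (simp add: power_add)
  qed
  then have "((\<lambda>_. 0) \<longlongrightarrow> d (0 + m)) (at (0::real))"
    using \<open>0 < r\<close> by (intro powser_limit_0_strong[where s = r]) auto
  then show ?case
    by (simp add: tendsto_const_iff)
qed

lemma power_series_coeff_unique:
  fixes c d :: "nat \<Rightarrow> real"
  assumes "0 < r" 
    and "\<And>z. norm z < r \<Longrightarrow> (\<lambda>n. c n * z ^ n) sums f z"
    and "\<And>z. norm z < r \<Longrightarrow> (\<lambda>n. d n * z ^ n) sums f z"
  shows "c = d"
proof
  fix n
  have "(\<lambda>n. (c n - d n) * z ^ n) sums 0" if "norm z < r" for z
    using sums_diff[OF assms(2,3)[OF that]] by (simp add: left_diff_distrib)
  then have "c n - d n = 0"
    using \<open>0 < r\<close> by (intro power_series_zero_coeff[where d = "\<lambda>n. c n - d n"]) auto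
  then show "c n = d n"
    by simp
qed

section \<open>Increments of subordinators\<close>

lemma subordinatorD:
  assumes "subordinator M X"
  shows subordinator_prob_space: "prob_space M"
    and subordinator_measurable: "0 \<le> t \<Longrightarrow> X t \<in> borel_measurable M"
    and subordinator_right_continuous:
      "\<omega> \<in> space M \<Longrightarrow> 0 \<le> t \<Longrightarrow> continuous (at_right t) (\<lambda>s. X s \<omega>)"
    and subordinator_zero: "\<omega> \<in> space M \<Longrightarrow> X 0 \<omega> = 0"
    and subordinator_mono: "\<omega> \<in> space M \<Longrightarrow> 0 \<le> s \<Longrightarrow> s \<le> t \<Longrightarrow> X s \<omega> \<le> X t \<omega>"
    and subordinator_nonneg: "\<omega> \<in> space M \<Longrightarrow> 0 \<le> t \<Longrightarrow> 0 \<le> X t \<omega>"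
proof -
  show "0 \<le> t \<Longrightarrow> X t \<in> borel_measurable M"
    "\<omega> \<in> space M \<Longrightarrow> 0 \<le> t \<Longrightarrow> continuous (at_right t) (\<lambda>s. X s \<omega>)"
    "\<omega> \<in> space M \<Longrightarrow> X 0 \<omega> = 0" "prob_space M"
    using assms by (auto simp: subordinator_def)
  show mono: "\<omega> \<in> space M \<Longrightarrow> 0 \<le> s \<Longrightarrow> s \<le> t \<Longrightarrow> X s \<omega> \<le> X t \<omega>" for s t
    using assms by (auto simp: subordinator_def mono_on_def)
  show "\<omega> \<in> space M \<Longrightarrow> 0 \<le> t \<Longrightarrow> 0 \<le> X t \<omega>"
    using mono[of 0 t] assms by (auto simp: subordinator_def)
qed

lemma distr_increment:
  assumes "subordinator M X" "0 \<le> s" "s \<le> t"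
  shows "distr M borel (\<lambda>\<omega>. X t \<omega> - X s \<omega>) = distr M borel (X (t - s))"
proof -
  have "\<forall>s\<ge>0. \<forall>h\<ge>0. distr M borel (\<lambda>\<omega>. X (s + h) \<omega> - X s \<omega>) = distr M borel (X h)"
    using assms(1) by (simp add: subordinator_def stationary_increments_def)
  from this[rule_format, of s "t - s"] show ?thesis
    using assms(2,3) by simp
qed

lemma nn_integral_increment:
  assumes "subordinator M X" "0 \<le> s" "s \<le> t" "g \<in> borel_measurable borel"
  shows "(\<integral>\<^sup>+ \<omega>. g (X t \<omega> - X s \<omega>) \<partial>M) = (\<integral>\<^sup>+ \<omega>. g (X (t - s) \<omega>) \<partial>M)"
proof -
  have [measurable]: "X t \<in> borel_measurable M" "X s \<in> borel_measurable M" "X (t - s) \<in> borel_measurable M"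
    using assms by (auto intro: subordinator_measurable)
  have "(\<integral>\<^sup>+ \<omega>. g (X t \<omega> - X s \<omega>) \<partial>M) = (\<integral>\<^sup>+ x. g x \<partial>distr M borel (\<lambda>\<omega>. X t \<omega> - X s \<omega>))"
    using assms(4) by (subst nn_integral_distr) simp_all
  also have "\<dots> = (\<integral>\<^sup>+ \<omega>. g (X (t - s) \<omega>) \<partial>M)"
    unfolding distr_increment[OF assms(1-3)] using assms(4) by (subst nn_integral_distr) simp_all
  finally show ?thesis .
qed

text \<open>Test functions cover both uses: indicators for the Poisson process and Poisson weights
  for \<open>E\<close>.\<close>

lemma nn_integral_independent_increment:
  assumes X: "subordinator M X" and "0 \<le> s" "s \<le> t" 
    and [measurable]: "f \<in> borel_measurable borel" "g \<in> borel_measurable borel"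
  shows "(\<integral>\<^sup>+ \<omega>. f (X s \<omega>) * g (X t \<omega> - X s \<omega>) \<partial>M) =
    (\<integral>\<^sup>+ \<omega>. f (X s \<omega>) \<partial>M) * (\<integral>\<^sup>+ \<omega>. g (X (t - s) \<omega>) \<partial>M)"
proof -
  interpret prob_space M
    using X by (rule subordinator_prob_space)
  \<comment> \<open>The partition 0, s, t, t, ..., of which the first two increments are
    used.\<close>
  define T where "T i = (case i of 0 \<Rightarrow> 0 | Suc 0 \<Rightarrow> s | Suc (Suc _) \<Rightarrow> t)" for i
  have T_0: "T 0 = 0"
    by (simp add: T_def)
  have "incseq T"
    using assms(2,3) by (intro incseq_SucI) (auto simp: T_def split: nat.split)
  then have "indep_vars (\<lambda>_. borel) (\<lambda>i \<omega>. X (T (Suc i)) \<omega> - X (T i) \<omega>) {..<2}"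
    using X by (auto simp: subordinator_def independent_increments_def T_0)
  then have "indep_vars (\<lambda>_. borel) (\<lambda>i \<omega>. case_nat f (\<lambda>_. g) i (X (T (Suc i)) \<omega> - X (T i) \<omega>)) {..<2}"
    by (rule indep_vars_compose2) (auto split: nat.split)
  from indep_vars_nn_integral[OF _ this]
  have "(\<integral>\<^sup>+ \<omega>. f (X s \<omega> - X 0 \<omega>) * g (X t \<omega> - X s \<omega>) \<partial>M) =
    (\<integral>\<^sup>+ \<omega>. f (X s \<omega> - X 0 \<omega>) \<partial>M) * (\<integral>\<^sup>+ \<omega>. g (X t \<omega> - X s \<omega>) \<partial>M)"
    by (simp add: T_def numeral_2_eq_2)
  then show ?thesis
    using subordinator_zero[OF X] nn_integral_increment[OF X assms(2,3,5)]
    by (simp cong: nn_integral_cong)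
qed

lemma exponential_processD:
  assumes "exponential_process M b E"
  shows exponential_process_subordinator: "subordinator M E"
    and exponential_process_laplace:
      "0 \<le> t \<Longrightarrow> 0 \<le> u \<Longrightarrow> (\<integral> \<omega>. exp (- (u * E t \<omega>)) \<partial>M) = (1 + u / b) powr (- t)"
  using assms by (auto simp: exponential_process_def)

section \<open>Poisson weights and their mixtures over exponential processes\<close>

definition poisson_weight :: "nat \<Rightarrow> real \<Rightarrow> real" where
  "poisson_weight j x = exp (- x) * x ^ j / fact j"

lemma poisson_weight_nonneg [simp]: "0 \<le> x \<Longrightarrow> 0 \<le> poisson_weight j x"
  by (simp add: poisson_weight_def)

lemma borel_measurable_poisson_weight [measurable]: "poisson_weight j \<in> borel_measurable borel"
  unfolding poisson_weight_def by measurable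

text \<open>The right-hand side is a Laplace kernel at \<open>1 - z\<close>, so averaging over a
  random \<open>x\<close> gives a Laplace transform; \<open>z = 1\<close> gives total mass
  one.\<close>

lemma poisson_weight_sums: "(\<lambda>j. poisson_weight j x * z ^ j) sums exp (- ((1 - z) * x))"
proof -
  have "(\<lambda>j. exp (- x) * ((x * z) ^ j /\<^sub>R fact j)) sums (exp (- x) * exp (x * z))"
    by (intro sums_mult exp_converges)
  moreover have "exp (- x) * ((x * z) ^ j /\<^sub>R fact j) = poisson_weight j x * z ^ j" for j
    by (simp add: poisson_weight_def power_mult_distrib divide_inverse)
  moreover have "exp (- x) * exp (x * z) = exp (- ((1 - z) * x))"
    by (simp add: algebra_simps flip: exp_add)
  ultimately show ?thesis
    by simp
qed

lemma poisson_weight_le_1: 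
  assumes "0 \<le> x"
  shows "poisson_weight j x \<le> 1"
proof -
  have "(\<lambda>j. poisson_weight j x) sums 1"
    using poisson_weight_sums[of x 1] by simp
  then show ?thesis
    using sum_le_suminf[of "\<lambda>j. poisson_weight j x" "{j}"] assms by (simp add: sums_iff)
qed

text \<open>The generating function of a Poisson mixture is a Laplace transform of the mixing law; for
  the exponential process it is a binomial series, whose coefficients are read off.\<close>
lemma expectation_poisson_weight:
  assumes E: "exponential_process M b E" and "0 < b" "0 < l" "0 \<le> t"
  shows "(\<integral> \<omega>. poisson_weight j (l * E t \<omega>) \<partial>M) =
    (b / (b + l)) powr t * (l / (b + l)) ^ j * ((t + real j - 1) gchoose j)"
proof -
  have S: "subordinator M E"
    using E by (rule exponential_process_subordinator)
  interpret prob_space M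
    using S by (rule subordinator_prob_space)
  have [measurable]: "E t \<in> borel_measurable M"
    using S \<open>0 \<le> t\<close> by (rule subordinator_measurable)
  have nonneg: "0 \<le> l * E t \<omega>" if "\<omega> \<in> space M" for \<omega>
    using subordinator_nonneg[OF S that \<open>0 \<le> t\<close>] \<open>0 < l\<close> by simp
  \<comment> \<open>\<open>p\<close> and \<open>r\<close> come from writing
    \<open>1 + l * (1 - z) / b\<close> as \<open>(1 - r * z) / p\<close>, whose power
    \<open>- t\<close> is a binomial series in \<open>r * z\<close>.\<close>
  define p where "p = b / (b + l)"
  define r where "r = l / (b + l)"
  have r: "0 < r" "r < 1" "p = 1 - r"
    using assms by (auto simp: r_def p_def field_simps)
  define G where "G z = (1 + l * (1 - z) / b) powr (- t)" for z
  have "(\<lambda>j. (\<integral> \<omega>. poisson_weight j (l * E t \<omega>) \<partial>M)) =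
      (\<lambda>j. p powr t * r ^ j * ((t + real j - 1) gchoose j))"
  proof (rule power_series_coeff_unique[of 1])
    \<comment> \<open>For |z| < 1 the Laplace argument \<open>l * (1 - z)\<close> is nonnegative,
      and a geometric series dominates the exchange of sum and integral.\<close>
    fix z :: real assume z: "norm z < 1"
    have bound: "norm (poisson_weight j (l * E t \<omega>) * z ^ j) \<le> norm z ^ j" if "\<omega> \<in> space M" for j \<omega>
    proof -
      have "poisson_weight j (l * E t \<omega>) * \<bar>z ^ j\<bar> \<le> 1 * \<bar>z ^ j\<bar>"
        using poisson_weight_le_1[OF nonneg[OF that]] by (rule mult_right_mono) simp
      then show ?thesis
        using nonneg[OF that] by (simp add: abs_mult power_abs)
    qed
    have int: "integrable M (\<lambda>\<omega>. poisson_weight j (l * E t \<omega>) * z ^ j)" for j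
      by (rule integrable_const_bound[where B = "norm z ^ j"]) (use bound in \<open>auto simp del: norm_mult real_norm_def\<close>)
    have sm: "summable (\<lambda>j. norm (poisson_weight j (l * E t \<omega>) * z ^ j))" if "\<omega> \<in> space M" for \<omega>
      by (rule summable_comparison_test'[OF summable_geometric[of "norm z"], of 0])
        (use bound[OF that] z in auto)
    have smi: "summable (\<lambda>j. \<integral> \<omega>. norm (poisson_weight j (l * E t \<omega>) * z ^ j) \<partial>M)"
    proof (rule summable_comparison_test'[OF summable_geometric[of "norm z"], of 0])
      fix j
      have "(\<integral> \<omega>. norm (poisson_weight j (l * E t \<omega>) * z ^ j) \<partial>M) \<le> (\<integral> \<omega>. norm z ^ j \<partial>M)"
        by (rule integral_mono) (use int bound in \<open>auto simp del: norm_mult real_norm_def\<close>)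
      then show "norm (\<integral> \<omega>. norm (poisson_weight j (l * E t \<omega>) * z ^ j) \<partial>M) \<le> norm z ^ j"
        by (simp add: prob_space)
    qed (use z in auto)
    have "(\<integral> \<omega>. (\<Sum>j. poisson_weight j (l * E t \<omega>) * z ^ j) \<partial>M) =
        (\<Sum>j. \<integral> \<omega>. poisson_weight j (l * E t \<omega>) * z ^ j \<partial>M)"
      by (rule integral_suminf[OF int AE_I2[OF sm] smi])
    moreover have "(\<Sum>j. poisson_weight j (l * E t \<omega>) * z ^ j) = exp (- (l * (1 - z) * E t \<omega>))" for \<omega>
      using poisson_weight_sums[of "l * E t \<omega>" z] by (simp add: sums_iff mult_ac)
    moreover have "(\<integral> \<omega>. exp (- (l * (1 - z) * E t \<omega>)) \<partial>M) = G z"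
      using exponential_process_laplace[OF E, of t "l * (1 - z)"] assms z by (simp add: G_def)
    ultimately have "(\<Sum>j. \<integral> \<omega>. poisson_weight j (l * E t \<omega>) * z ^ j \<partial>M) = G z"
      by simp
    then show "(\<lambda>j. (\<integral> \<omega>. poisson_weight j (l * E t \<omega>) \<partial>M) * z ^ j) sums G z"
      using summable_integral[OF int AE_I2[OF sm] smi] by (simp add: sums_iff)
  next
    fix z :: real assume z: "norm z < 1"
    have "\<bar>r * z\<bar> < 1"
      using mult_strict_mono[of r 1 "\<bar>z\<bar>" 1] r z by (simp add: abs_mult)
    then have rz: "\<bar>- (r * z)\<bar> < 1" by simp
    have "(\<lambda>j. p powr t * (((- t) gchoose j) * (- (r * z)) ^ j)) sums (p powr t * (1 + (- (r * z))) powr (- t))"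
      by (intro sums_mult gen_binomial_real rz)
    moreover have "p powr t * (((- t) gchoose j) * (- (r * z)) ^ j) =
        p powr t * r ^ j * ((t + real j - 1) gchoose j) * z ^ j" for j
    proof -
      have "(- 1) ^ j * (- (r * z)) ^ j = (r * z) ^ j"
        by (simp flip: power_mult_distrib)
      then have "((- t) gchoose j) * (- (r * z)) ^ j = (r * z) ^ j * ((t + real j - 1) gchoose j)"
        unfolding gbinomial_minus by (metis mult.assoc mult.commute)
      then show ?thesis
        by (simp only: power_mult_distrib mult_ac)
    qed
    moreover have "p powr t * (1 + (- (r * z))) powr (- t) = G z"
    proof -
      have "1 + l * (1 - z) / b = (1 + (- (r * z))) / p"
      proof -
        have *: "r * (b + l) = l" "p * (b + l) = b" "b + l \<noteq> 0"
          using assms by (simp_all add: r_def p_def)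
        have "(1 + (- (r * z))) * (b + l) = b + l - r * (b + l) * z"
          by (simp add: algebra_simps)
        then have "(1 + (- (r * z))) / p = (b + l - l * z) / b"
          using * by (metis mult_divide_mult_cancel_right)
        then show ?thesis
          using \<open>0 < b\<close> by (simp add: right_diff_distrib add_divide_distrib diff_divide_distrib)
      qed
      moreover have "0 < 1 + (- (r * z))" "0 < p"
        using rz r by auto
      ultimately show ?thesis
        unfolding G_def by (simp add: powr_divide powr_minus[of p] inverse_eq_divide)
    qed
    ultimately show "(\<lambda>j. p powr t * r ^ j * ((t + real j - 1) gchoose j) * z ^ j) sums G z"
      by simp
  qed simp
  then show ?thesis
    unfolding p_def r_def by metis
qed


section \<open>Hitting times and unit jumps\<close>

text \<open>Distinct naturals are at distance at least 1, so closeness forces equality.\<close>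

lemma eventually_eq_right_of_nat:
  fixes f :: "real \<Rightarrow> nat"
  assumes "continuous (at_right t) (\<lambda>s. real (f s))"
  shows "\<forall>\<^sub>F s in at_right t. f s = f t"
proof -
  have "((\<lambda>s. real (f s)) \<longlongrightarrow> real (f t)) (at_right t)"
    using assms by (simp add: continuous_within)
  then have "\<forall>\<^sub>F s in at_right t. dist (real (f s)) (real (f t)) < 1"
    by (rule tendstoD) simp
  then show ?thesis
    by eventually_elim (auto simp: dist_real_def)
qed

text \<open>The rational fractions of \<open>t\<close> are countable, contain \<open>t\<close> itself, which a dense subset of
  \<open>[0, t]\<close> could miss as a hitting point, and contain every uniform partition of \<open>[0, t]\<close>.\<close>
definition grid :: "real \<Rightarrow> real set" where
  "grid t = (\<lambda>(i, m). t * real i / real m) ` {(i, m). 0 < m \<and> i \<le> m}"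

lemma gridI: "0 < m \<Longrightarrow> i \<le> m \<Longrightarrow> t * real i / real m \<in> grid t"
  by (auto simp: grid_def)

lemma countable_grid [simp]: "countable (grid t)"
  unfolding grid_def by (rule countable_image) simp

lemma grid_subset:
  assumes "0 \<le> t" "u \<in> grid t"
  shows "0 \<le> u" "u \<le> t"
proof -
  obtain i m where u: "u = t * real i / real m" "0 < m" "i \<le> m"
    using assms(2) by (auto simp: grid_def)
  show "0 \<le> u"
    using u assms by simp
  have "t * real i \<le> t * real m"
    using u assms(1) by (intro mult_left_mono) auto
  then show "u \<le> t"
    using u by (simp add: pos_divide_le_eq)
qed

lemma grid_dense:
  assumes "0 \<le> u" "u < v" "v \<le> t"
  obtains w where "w \<in> grid t" "u < w" "w < v"
proof -
  have "0 < t" using assms by linarith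
  then have "u / t < v / t"
    using assms by (simp add: divide_strict_right_mono)
  then obtain q where q: "q \<in> \<rat>" "u / t < q" "q < v / t"
    using Rats_dense_in_real by blast
  have "0 \<le> u / t" "v / t \<le> 1"
    using assms \<open>0 < t\<close> by auto
  then have q01: "0 < q" "q < 1"
    using q by linarith+
  obtain i m :: nat where im: "m \<noteq> 0" "\<bar>q\<bar> = real i / real m"
    using q(1) by (rule Rats_abs_nat_div_natE)
  then have q_eq: "q = real i / real m"
    using q01 by simp
  have "i \<le> m"
    using q01 im(1) unfolding q_eq by (simp add: pos_divide_less_eq)
  then have "t * q \<in> grid t"
    using gridI[of m i t] im(1) by (simp add: q_eq)
  moreover have "u < t * q" "t * q < v"
    using q \<open>0 < t\<close> by (simp_all add: pos_divide_less_eq pos_less_divide_eq mult.commute)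
  ultimately show ?thesis
    using that by blast
qed

text \<open>Constancy to the right does two things: without a hit by time \<open>t\<close> the
  infimum is strictly beyond \<open>t\<close>, and a hit at \<open>u < t\<close> lasts long enough
  to meet the grid.\<close>

lemma hitting_time_le_iff:
  assumes rc: "\<And>u. 0 \<le> u \<Longrightarrow> \<forall>\<^sub>F s in at_right u. X s \<omega> = X u \<omega>"
    and "0 \<le> t"
  shows "hitting_time X k \<omega> \<le> ereal t \<longleftrightarrow> (\<exists>u\<in>grid t. X u \<omega> = k)"
proof
  assume le: "hitting_time X k \<omega> \<le> ereal t"
  have "\<exists>u. 0 \<le> u \<and> u \<le> t \<and> X u \<omega> = k"
  proof (rule ccontr)
    assume no: "\<not> ?thesis"
    obtain b where b: "t < b" "\<And>s. t < s \<Longrightarrow> s < b \<Longrightarrow> X s \<omega> = X t \<omega>"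
      using rc[OF \<open>0 \<le> t\<close>] by (auto simp: eventually_at_right_field)
    have "ereal b \<le> hitting_time X k \<omega>"
      unfolding hitting_time_def
    proof (rule Inf_greatest, clarsimp)
      fix s assume s: "0 \<le> s" "k = X s \<omega>"
      show "b \<le> s"
        using no b(2)[of s] s \<open>0 \<le> t\<close> by (metis linorder_not_le order_le_less)
    qed
    then have "ereal b \<le> ereal t"
      using le by (rule order_trans)
    then show False
      using b(1) by simp
  qed
  then obtain u where u: "0 \<le> u" "u \<le> t" "X u \<omega> = k"
    by blast
  show "\<exists>u\<in>grid t. X u \<omega> = k"
  proof (cases "u = t")
    case True
    then show ?thesis
      using u gridI[of 1 1 t] by auto
  next
    case False
    obtain b where b: "u < b" "\<And>s. u < s \<Longrightarrow> s < b \<Longrightarrow> X s \<omega> = X u \<omega>"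
      using rc[OF u(1)] by (auto simp: eventually_at_right_field)
    obtain w where "w \<in> grid t" "u < w" "w < min b t"
      using grid_dense[of u "min b t" t] u b(1) False by auto
    then show ?thesis
      using b(2) u by (intro bexI[of _ w]) auto
  qed
next
  assume "\<exists>u\<in>grid t. X u \<omega> = k"
  then obtain u where u: "u \<in> grid t" "X u \<omega> = k"
    by blast
  have "hitting_time X k \<omega> \<le> ereal u"
    unfolding hitting_time_def using u grid_subset[OF \<open>0 \<le> t\<close> u(1)] by (intro Inf_lower) auto
  also have "ereal u \<le> ereal t"
    using grid_subset[OF \<open>0 \<le> t\<close> u(1)] by simp
  finally show "hitting_time X k \<omega> \<le> ereal t" .
qed

lemma hitting_time_nonneg: "0 \<le> hitting_time X k \<omega>"
  unfolding hitting_time_def by (intro Inf_greatest) auto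

section \<open>Poisson processes: tails and unit jumps\<close>

lemma poisson_processD:
  assumes "poisson_process M l N"
  shows poisson_process_subordinator: "subordinator M (\<lambda>t \<omega>. real (N t \<omega>))"
    and poisson_process_law:
      "0 \<le> t \<Longrightarrow> measure M {\<omega> \<in> space M. N t \<omega> = n} = poisson_weight n (l * t)"
  using assms by (auto simp: poisson_process_def poisson_weight_def)

lemma poisson_process_measurable:
  assumes "poisson_process M l N" "0 \<le> t"
  shows "N t \<in> measurable M (count_space UNIV)"
proof -
  have "(\<lambda>\<omega>. nat \<lfloor>real (N t \<omega>)\<rfloor>) \<in> measurable M (count_space UNIV)"
    using subordinator_measurable[OF poisson_process_subordinator[OF assms(1)] assms(2)] by measurable
  then show ?thesis by simp
qed

lemma poisson_process_mono:
  assumes "poisson_process M l N" "\<omega> \<in> space M" "0 \<le> s" "s \<le> t"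
  shows "N s \<omega> \<le> N t \<omega>"
  using subordinator_mono[OF poisson_process_subordinator[OF assms(1)] assms(2-4)] by simp

lemma poisson_process_emeasure:
  assumes N: "poisson_process M l N" and "0 \<le> t"
  shows "emeasure M {\<omega> \<in> space M. N t \<omega> = n} = ennreal (poisson_weight n (l * t))"
proof -
  interpret prob_space M
    by (rule subordinator_prob_space[OF poisson_process_subordinator[OF N]])
  show ?thesis
    using poisson_process_law[OF assms] by (simp add: emeasure_eq_measure)
qed

text \<open>The index is shifted: \<open>erlang_CDF n\<close> is the distribution function of a sum
  of \<open>n + 1\<close> exponential times, the time at which \<open>N\<close> exceeds
  \<open>n\<close>.\<close>

lemma poisson_process_tail:
  assumes N: "poisson_process M l N" and "0 \<le> t"
  shows "measure M {\<omega> \<in> space M. n < N t \<omega>} = erlang_CDF n l t"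
proof -
  interpret prob_space M
    by (rule subordinator_prob_space[OF poisson_process_subordinator[OF N]])
  note [measurable] = poisson_process_measurable[OF assms]
  have "prob {\<omega> \<in> space M. n < N t \<omega>} = 1 - prob {\<omega> \<in> space M. N t \<omega> \<le> n}"
    by (subst prob_compl[symmetric]) (auto intro!: arg_cong[where f = prob])
  also have "{\<omega> \<in> space M. N t \<omega> \<le> n} = (\<Union>i\<le>n. {\<omega> \<in> space M. N t \<omega> = i})"
    by auto
  also have "prob \<dots> = (\<Sum>i\<le>n. prob {\<omega> \<in> space M. N t \<omega> = i})"
    by (rule finite_measure_finite_Union) (auto simp: disjoint_family_on_def)
  also have "1 - \<dots> = erlang_CDF n l t"
    using assms by (simp add: poisson_process_law poisson_weight_def erlang_CDF_def mult.commute)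
  finally show ?thesis .
qed

text \<open>With x = \<open>l * (t - s)\<close> the probability is 1 - (1 + x) exp(-x), and exp(-x)
  >= 1 - x bounds it by x^2. The square is essential: summed over m cells of length t/m it is of
  order 1/m.\<close>

lemma poisson_process_jump_ge_2:
  assumes N: "poisson_process M l N" and "0 < l" and "0 \<le> s" "s \<le> t"
  shows "emeasure M {\<omega> \<in> space M. N s \<omega> + 1 < N t \<omega>} \<le> ennreal ((l * (t - s))\<^sup>2)"
proof -
  have S: "subordinator M (\<lambda>t \<omega>. real (N t \<omega>))"
    using N by (rule poisson_process_subordinator)
  interpret prob_space M
    by (rule subordinator_prob_space[OF S])
  have [measurable]: "N s \<in> borel_measurable M" "N t \<in> borel_measurable M"
     "N (t - s) \<in> borel_measurable M"
    using assms by (auto intro!: measurable_compose[OF poisson_process_measurable[OF N], of _ "\<lambda>x. x"])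
  have sets: "{\<omega> \<in> space M. N s \<omega> + 1 < N t \<omega>} \<in> events" "{\<omega> \<in> space M. 1 < N (t - s) \<omega>} \<in> events"
    by measurable
  have "emeasure M {\<omega> \<in> space M. N s \<omega> + 1 < N t \<omega>} =
      (\<integral>\<^sup>+ \<omega>. indicator {1<..} (real (N t \<omega>) - real (N s \<omega>)) \<partial>M)"
    unfolding nn_integral_indicator[OF sets(1), symmetric]
    by (intro nn_integral_cong) (auto split: split_indicator)
  also have "\<dots> = (\<integral>\<^sup>+ \<omega>. indicator {1<..} (real (N (t - s) \<omega>)) \<partial>M)"
    by (rule nn_integral_increment[OF S assms(3,4)]) simp
  also have "\<dots> = emeasure M {\<omega> \<in> space M. 1 < N (t - s) \<omega>}"
    unfolding nn_integral_indicator[OF sets(2), symmetric]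
    by (intro nn_integral_cong) (auto split: split_indicator)
  also have "\<dots> = ennreal (erlang_CDF 1 l (t - s))"
    using poisson_process_tail[OF N, of "t - s" 1] assms by (simp add: emeasure_eq_measure)
  also have "\<dots> \<le> ennreal ((l * (t - s))\<^sup>2)"
  proof (rule ennreal_leI)
    let ?x = "l * (t - s)"
    have "0 \<le> ?x"
      using assms by simp
    then have "(1 + ?x) * (1 - ?x) \<le> (1 + ?x) * exp (- ?x)"
      using exp_ge_add_one_self[of "- ?x"] by (intro mult_left_mono) auto
    then show "erlang_CDF 1 l (t - s) \<le> ?x\<^sup>2"
      using assms by (simp add: erlang_CDF_def power2_eq_square algebra_simps)
  qed
  finally show ?thesis .
qed

text \<open>For each m some cell has an increment above 1 with probability at most (l t)^2 / m, so
  almost surely some m has no such cell. This sampled form avoids jump times of paths and uses only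
  times of the grid.\<close>

lemma AE_poisson_process_unit_jumps:
  assumes N: "poisson_process M l N" and "0 < l" and "0 \<le> t"
  shows "AE \<omega> in M. \<exists>m>0. \<forall>i<m. N (t * real (Suc i) / real m) \<omega> \<le> N (t * real i / real m) \<omega> + 1"
proof -
  interpret prob_space M
    by (rule subordinator_prob_space[OF poisson_process_subordinator[OF N]])
  define J where "J m i = {\<omega> \<in> space M. N (t * real i / real m) \<omega> + 1 < N (t * real (Suc i) / real m) \<omega>}" for m i
  define B where "B = (\<Inter>n. \<Union>i<Suc n. J (Suc n) i)"
  have [measurable]: "N (t * real i / real m) \<in> borel_measurable M" for i m
    using \<open>0 \<le> t\<close> by (auto intro!: measurable_compose[OF poisson_process_measurable[OF N], of _ "\<lambda>x. x"])
  have J[measurable]: "J m i \<in> sets M" for m i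
    unfolding J_def by measurable
  have B[measurable]: "B \<in> sets M"
    unfolding B_def using J by (intro sets.countable_INT) auto
  have le: "emeasure M B \<le> ennreal ((l * t)\<^sup>2 / real (Suc n))" for n
  proof -
    let ?m = "Suc n"
    have "emeasure M B \<le> emeasure M (\<Union>i<?m. J ?m i)"
      by (rule emeasure_mono) (auto simp: B_def)
    also have "\<dots> \<le> (\<Sum>i<?m. emeasure M (J ?m i))"
      by (rule emeasure_subadditive_finite) auto
    also have "\<dots> \<le> (\<Sum>i<?m. ennreal ((l * t / real ?m)\<^sup>2))"
    proof (rule sum_mono)
      fix i
      have "t * real (Suc i) / real ?m - t * real i / real ?m = t / real ?m"
        by (simp add: diff_divide_distrib[symmetric] distrib_left del: of_nat_Suc) (simp add: algebra_simps)
      moreover have "t * real i / real ?m \<le> t * real (Suc i) / real ?m"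
        using \<open>0 \<le> t\<close> by (intro divide_right_mono mult_left_mono) auto
      ultimately show "emeasure M (J ?m i) \<le> ennreal ((l * t / real ?m)\<^sup>2)"
        using poisson_process_jump_ge_2[OF N \<open>0 < l\<close>, of "t * real i / real ?m" "t * real (Suc i) / real ?m"] \<open>0 \<le> t\<close>
        unfolding J_def by (simp del: of_nat_Suc)
    qed
    also have "\<dots> = ennreal (real ?m * (l * t / real ?m)\<^sup>2)"
      by (simp add: ennreal_mult' ennreal_of_nat_eq_real_of_nat del: of_nat_Suc)
    also have "real ?m * (l * t / real ?m)\<^sup>2 = (l * t)\<^sup>2 / real ?m"
      by (simp add: power2_eq_square del: of_nat_Suc)
    finally show ?thesis .
  qed
  have "emeasure M B \<le> 0"
  proof (rule LIMSEQ_le_const)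
    have "(\<lambda>n. (l * t)\<^sup>2 / real (Suc n)) \<longlonglongrightarrow> 0"
      using tendsto_mult_right_zero[OF LIMSEQ_inverse_real_of_nat, of "(l * t)\<^sup>2"] by (simp add: divide_inverse)
    then show "(\<lambda>n. ennreal ((l * t)\<^sup>2 / real (Suc n))) \<longlonglongrightarrow> 0"
      using tendsto_ennrealI by fastforce
  qed (use le in blast)
  then have "B \<in> null_sets M"
    using B by auto
  then show ?thesis
    by (rule AE_I') (auto simp: B_def J_def not_le simp del: of_nat_Suc)
qed

lemma image_grid_unit_jumps:
  fixes f :: "real \<Rightarrow> nat"
  assumes "0 \<le> t" and mono: "\<And>u. 0 \<le> u \<Longrightarrow> u \<le> t \<Longrightarrow> f u \<le> f t" and "f 0 = 0"
    and "0 < m" and jumps: "\<And>i. i < m \<Longrightarrow> f (t * real (Suc i) / real m) \<le> f (t * real i / real m) + 1"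
  shows "f ` grid t = {..f t}"
proof (intro equalityI subsetI)
  fix n assume "n \<in> f ` grid t"
  then show "n \<in> {..f t}"
    using mono grid_subset[OF \<open>0 \<le> t\<close>] by auto
next
  fix n assume n: "n \<in> {..f t}"
  let ?g = "\<lambda>i. f (t * real i / real m)"
  \<comment> \<open>The last partition point with value at most \<open>n\<close>: the next value
    exceeds \<open>n\<close> but is larger by at most 1, which forces equality. If it is the
    endpoint, \<open>n \<le> f t\<close> does the same.\<close>
  define i where "i = (GREATEST i. i \<le> m \<and> ?g i \<le> n)"
  have "0 \<le> m \<and> ?g 0 \<le> n"
    using \<open>f 0 = 0\<close> by simp
  then have i: "i \<le> m" "?g i \<le> n"
    unfolding i_def by (metis (mono_tags, lifting) GreatestI_nat)+
  have "?g i = n"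
  proof (cases "i = m")
    case True
    then show ?thesis
      using n i \<open>0 < m\<close> by simp
  next
    case False
    have "\<not> (Suc i \<le> m \<and> ?g (Suc i) \<le> n)"
    proof
      assume "Suc i \<le> m \<and> ?g (Suc i) \<le> n"
      then have "Suc i \<le> i"
        unfolding i_def by (rule Greatest_le_nat) auto
      then show False by simp
    qed
    then show ?thesis
      using i False jumps[of i] by force
  qed
  then show "n \<in> f ` grid t"
    using gridI[OF \<open>0 < m\<close> i(1)] by blast
qed


section \<open>Negative binomial laws\<close>

lemma gbinomial_add_nonneg:
  fixes t :: real
  assumes "0 \<le> t"
  shows "0 \<le> (t + real n - 1) gchoose n"
  using assms by (simp add: gbinomial_pochhammer' pochhammer_prod prod_nonneg)

lemma nn_integral_poisson_weight:
  assumes E: "exponential_process M b E" and "0 < b" "0 < l" "0 \<le> t"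
  shows "(\<integral>\<^sup>+ \<omega>. ennreal (poisson_weight j (l * E t \<omega>)) \<partial>M) =
    ennreal ((b / (b + l)) powr t * (l / (b + l)) ^ j * ((t + real j - 1) gchoose j))"
proof -
  have S: "subordinator M E"
    using E by (rule exponential_process_subordinator)
  interpret prob_space M
    using S by (rule subordinator_prob_space)
  have [measurable]: "E t \<in> borel_measurable M"
    using S \<open>0 \<le> t\<close> by (rule subordinator_measurable)
  have nonneg: "0 \<le> l * E t \<omega>" if "\<omega> \<in> space M" for \<omega>
    using subordinator_nonneg[OF S that \<open>0 \<le> t\<close>] \<open>0 < l\<close> by simp
  have "integrable M (\<lambda>\<omega>. poisson_weight j (l * E t \<omega>))"
    using nonneg by (intro integrable_const_bound[where B = 1]) (auto simp: poisson_weight_le_1)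
  then show ?thesis
    unfolding expectation_poisson_weight[OF assms, symmetric]
    using nonneg by (intro nn_integral_eq_integral) auto
qed

lemma poisson_process_increments_law:
  assumes N: "poisson_process M l N" and "0 \<le> s" "s \<le> t"
  shows "emeasure M {\<omega> \<in> space M. N s \<omega> = i \<and> N t \<omega> = i + j} =
    ennreal (poisson_weight i (l * s)) * ennreal (poisson_weight j (l * (t - s)))"
proof -
  have S: "subordinator M (\<lambda>t \<omega>. real (N t \<omega>))"
    using N by (rule poisson_process_subordinator)
  interpret prob_space M
    by (rule subordinator_prob_space[OF S])
  have [measurable]: "N s \<in> measurable M (count_space UNIV)" "N t \<in> measurable M (count_space UNIV)"
     "N (t - s) \<in> measurable M (count_space UNIV)"
    using assms by (auto intro: poisson_process_measurable[OF N])
  have law: "(\<integral>\<^sup>+ \<omega>. indicator {real n} (real (N u \<omega>)) \<partial>M) = ennreal (poisson_weight n (l * u))"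
    if "0 \<le> u" for n u
  proof -
    note [measurable] = poisson_process_measurable[OF N that]
    have "(\<integral>\<^sup>+ \<omega>. indicator {real n} (real (N u \<omega>)) \<partial>M) = (\<integral>\<^sup>+ \<omega>. indicator {\<omega> \<in> space M. N u \<omega> = n} \<omega> \<partial>M)"
      by (intro nn_integral_cong) (auto split: split_indicator)
    then show ?thesis
      by (simp add: poisson_process_emeasure[OF N that])
  qed
  have "emeasure M {\<omega> \<in> space M. N s \<omega> = i \<and> N t \<omega> = i + j} =
      (\<integral>\<^sup>+ \<omega>. indicator {\<omega> \<in> space M. N s \<omega> = i \<and> N t \<omega> = i + j} \<omega> \<partial>M)"
    by (rule nn_integral_indicator[symmetric]) measurable
  also have "\<dots> = (\<integral>\<^sup>+ \<omega>. indicator {real i} (real (N s \<omega>)) * indicator {real j} (real (N t \<omega>) - real (N s \<omega>)) \<partial>M)"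
    by (intro nn_integral_cong) (auto split: split_indicator)
  also have "\<dots> = (\<integral>\<^sup>+ \<omega>. indicator {real i} (real (N s \<omega>)) \<partial>M) * (\<integral>\<^sup>+ \<omega>. indicator {real j} (real (N (t - s) \<omega>)) \<partial>M)"
    by (rule nn_integral_independent_increment[OF S assms(2,3)]) auto
  also have "\<dots> = ennreal (poisson_weight i (l * s)) * ennreal (poisson_weight j (l * (t - s)))"
    using assms by (simp add: law)
  finally show ?thesis .
qed

lemma poisson_process_crossing:
  assumes N: "poisson_process M l N" and "0 \<le> s" "s \<le> t"
  shows "emeasure M {\<omega> \<in> space M. N s \<omega> < k \<and> N t \<omega> = k} =
    (\<Sum>j<k. ennreal (poisson_weight j (l * s)) * ennreal (poisson_weight (k - j) (l * (t - s))))"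
proof -
  have [measurable]: "N s \<in> measurable M (count_space UNIV)" "N t \<in> measurable M (count_space UNIV)"
    using assms by (auto intro: poisson_process_measurable[OF N])
  have "{\<omega> \<in> space M. N s \<omega> < k \<and> N t \<omega> = k} = (\<Union>j<k. {\<omega> \<in> space M. N s \<omega> = j \<and> N t \<omega> = j + (k - j)})"
    by auto
  moreover have "emeasure M \<dots> = (\<Sum>j<k. emeasure M {\<omega> \<in> space M. N s \<omega> = j \<and> N t \<omega> = j + (k - j)})"
    by (rule sum_emeasure[symmetric]) (auto simp: disjoint_family_on_def)
  ultimately show ?thesis
    by (simp only: poisson_process_increments_law[OF assms])
qed

text \<open>Parallel summation gives lower index \<open>k - 1\<close>, and symmetry turns it into
  \<open>n\<close>; this is where level and step number exchange roles. The generalized coefficient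
  covers \<open>n = 0\<close>, where only \<open>j = 0\<close> contributes.\<close>

lemma sum_negative_binomial:
  assumes "1 \<le> k"
  shows "(\<Sum>j<k. (real n + real j - 1) gchoose j) = (real k + real n - 1) gchoose n"
proof -
  obtain m where k: "k = Suc m"
    using assms by (cases k) auto
  have "(\<Sum>j<k. (real n + real j - 1) gchoose j) = (\<Sum>j\<le>m. ((real n - 1) + of_nat j) gchoose j)"
    unfolding k lessThan_Suc_atMost by (intro sum.cong refl arg_cong2[where f = "(gchoose)"]) simp
  also have "\<dots> = real (n + m) gchoose m"
    by (subst gbinomial_parallel_sum) simp
  also have "\<dots> = real (m + n) gchoose n"
    unfolding binomial_gbinomial[symmetric] using binomial_symmetric[of n "n + m"] by (simp add: add.commute)
  finally show ?thesis
    by (simp add: k)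
qed

text \<open>Given \<open>E\<close>, the event is that the Poisson process jumps onto level \<open>k\<close> between the times \<open>E n\<close>
  and \<open>E (n + 1)\<close>; averaging over the independent increments of \<open>E\<close> gives a convolution of negative
  binomial probabilities.\<close>
lemma nn_integral_crossing:
  assumes N: "poisson_process M l N" and E: "exponential_process M' b E" and "0 < b" "0 < l" "1 \<le> k"
  shows "(\<integral>\<^sup>+ \<omega>'. emeasure M {\<omega> \<in> space M. N (E (real n) \<omega>') \<omega> < k \<and> N (E (real (Suc n)) \<omega>') \<omega> = k} \<partial>M') =
    ennreal (b / (l + b) * ((l / (l + b)) powr real k * (b / (l + b)) ^ n * ((real k + real n - 1) gchoose n)))"
proof -
  have S: "subordinator M' E"
    using E by (rule exponential_process_subordinator)
  interpret prob_space M'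
    using S by (rule subordinator_prob_space)
  have [measurable]: "E (real n) \<in> borel_measurable M'" for n
    using S by (rule subordinator_measurable) simp
  let ?p = "b / (b + l)" and ?r = "l / (b + l)"
  have pr: "0 < ?p" "0 < ?r"
    using assms by auto
  have "(\<integral>\<^sup>+ \<omega>'. emeasure M {\<omega> \<in> space M. N (E (real n) \<omega>') \<omega> < k \<and> N (E (real (Suc n)) \<omega>') \<omega> = k} \<partial>M') =
    (\<integral>\<^sup>+ \<omega>'. (\<Sum>j<k. ennreal (poisson_weight j (l * E (real n) \<omega>')) *
       ennreal (poisson_weight (k - j) (l * (E (real (Suc n)) \<omega>' - E (real n) \<omega>')))) \<partial>M')"
    using subordinator_nonneg[OF S] subordinator_mono[OF S]
    by (intro nn_integral_cong poisson_process_crossing[OF N]) auto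
  also have "\<dots> = (\<Sum>j<k. \<integral>\<^sup>+ \<omega>'. ennreal (poisson_weight j (l * E (real n) \<omega>')) *
       ennreal (poisson_weight (k - j) (l * (E (real (Suc n)) \<omega>' - E (real n) \<omega>'))) \<partial>M')"
    by (rule nn_integral_sum) measurable
  \<comment> \<open>After \<open>n\<close> steps the law is negative binomial; the one further step
    is geometric, as its binomial coefficient is 1.\<close>
  also have "\<dots> = (\<Sum>j<k. ennreal (?p powr real n * ?r ^ j * ((real n + real j - 1) gchoose j)) *
      ennreal (?p * ?r ^ (k - j)))"
  proof (rule sum.cong[OF refl])
    fix j
    have "(\<integral>\<^sup>+ \<omega>'. ennreal (poisson_weight j (l * E (real n) \<omega>')) *
       ennreal (poisson_weight (k - j) (l * (E (real (Suc n)) \<omega>' - E (real n) \<omega>'))) \<partial>M') =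
      (\<integral>\<^sup>+ \<omega>'. ennreal (poisson_weight j (l * E (real n) \<omega>')) \<partial>M') *
      (\<integral>\<^sup>+ \<omega>'. ennreal (poisson_weight (k - j) (l * E (real (Suc n) - real n) \<omega>')) \<partial>M')"
      by (rule nn_integral_independent_increment[OF S, where
            f = "\<lambda>x. ennreal (poisson_weight j (l * x))" and g = "\<lambda>x. ennreal (poisson_weight (k - j) (l * x))"])
        (simp, simp, measurable)
    moreover have "(\<integral>\<^sup>+ \<omega>'. ennreal (poisson_weight (k - j) (l * E (real (Suc n) - real n) \<omega>')) \<partial>M') =
        ennreal (?p * ?r ^ (k - j))"
      using nn_integral_poisson_weight[OF E, of l 1 "k - j"] assms
      by (simp flip: binomial_gbinomial)
    ultimately show "(\<integral>\<^sup>+ \<omega>'. ennreal (poisson_weight j (l * E (real n) \<omega>')) *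
       ennreal (poisson_weight (k - j) (l * (E (real (Suc n)) \<omega>' - E (real n) \<omega>'))) \<partial>M') =
      ennreal (?p powr real n * ?r ^ j * ((real n + real j - 1) gchoose j)) * ennreal (?p * ?r ^ (k - j))"
      using assms by (simp add: nn_integral_poisson_weight[OF E])
  qed
  \<comment> \<open>The powers of \<open>?r\<close> combine to \<open>?r ^ k\<close>, so only the
    binomial coefficients depend on \<open>j\<close>.\<close>
  also have "\<dots> = (\<Sum>j<k. ennreal (?p * (?p ^ n * ?r ^ k) * ((real n + real j - 1) gchoose j)))"
  proof (rule sum.cong[OF refl])
    fix j assume "j \<in> {..<k}"
    then have "?r ^ k = ?r ^ j * ?r ^ (k - j)"
      by (simp flip: power_add)
    then have "?p powr real n * ?r ^ j * ((real n + real j - 1) gchoose j) * (?p * ?r ^ (k - j)) =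
      ?p * (?p ^ n * ?r ^ k) * ((real n + real j - 1) gchoose j)"
      using pr by (simp only: powr_realpow mult_ac)
    then show "ennreal (?p powr real n * ?r ^ j * ((real n + real j - 1) gchoose j)) * ennreal (?p * ?r ^ (k - j)) =
      ennreal (?p * (?p ^ n * ?r ^ k) * ((real n + real j - 1) gchoose j))"
      using pr by (simp only: ennreal_mult''[symmetric] mult_nonneg_nonneg less_imp_le zero_le_power)
  qed
  also have "\<dots> = ennreal (\<Sum>j<k. ?p * (?p ^ n * ?r ^ k) * ((real n + real j - 1) gchoose j))"
  proof (rule sum_ennreal)
    fix j
    have "0 \<le> (real n + real j - 1) gchoose j"
      by (rule gbinomial_add_nonneg) simp
    then show "0 \<le> ?p * (?p ^ n * ?r ^ k) * ((real n + real j - 1) gchoose j)"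
      using pr by (intro mult_nonneg_nonneg) auto
  qed
  also have "(\<Sum>j<k. ?p * (?p ^ n * ?r ^ k) * ((real n + real j - 1) gchoose j)) =
      b / (l + b) * ((l / (l + b)) powr real k * (b / (l + b)) ^ n * ((real k + real n - 1) gchoose n))"
    unfolding sum_distrib_left[symmetric] sum_negative_binomial[OF \<open>1 \<le> k\<close>]
    using pr by (simp add: powr_realpow add.commute mult_ac)
  finally show ?thesis .
qed

section \<open>Poisson processes at random times\<close>

lemma real_measurable_nat_borel [measurable]: "real \<in> borel_measurable borel"
  by (rule measurableI) (auto simp: sets_borel_eq_count_space)

text \<open>\<open>A\<close> is either \<open>M\<close> or the generated sigma-algebra to which the
  independence hypotheses refer, hence only its points are tied to \<open>M\<close>.\<close>

lemma poisson_process_random_time: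
  assumes N: "poisson_process M l N"
    and A: "space A = space M" "\<And>t. 0 \<le> t \<Longrightarrow> N t \<in> borel_measurable A"
    and f: "f \<in> borel_measurable B" "\<And>x. x \<in> space B \<Longrightarrow> 0 \<le> f x" and g: "g \<in> measurable B A"
  shows "(\<lambda>x. N (f x) (g x)) \<in> measurable B (count_space UNIV)"
proof -
  have "(\<lambda>x. real (N (f x) (g x))) \<in> borel_measurable B"
  proof (rule borel_measurable_right_continuous_process[OF _ _ f g])
    show "(\<lambda>\<omega>. real (N t \<omega>)) \<in> borel_measurable A" if "0 \<le> t" for t
      using A(2)[OF that] by measurable
    show "continuous (at_right t) (\<lambda>s. real (N s \<omega>))" if "\<omega> \<in> space A" "0 \<le> t" for \<omega> t
      using subordinator_right_continuous[OF poisson_process_subordinator[OF N]] that A(1) by simp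
  qed
  then have "(\<lambda>x. nat \<lfloor>real (N (f x) (g x))\<rfloor>) \<in> measurable B (count_space UNIV)"
    by measurable
  then show ?thesis
    by simp
qed

lemma poisson_process_borel_measurable:
  assumes "poisson_process M l N" "0 \<le> t"
  shows "N t \<in> borel_measurable M"
  by (rule measurable_compose[OF poisson_process_measurable[OF assms], of "\<lambda>x. x"]) simp

text \<open>With \<open>E t\<close> held fixed the law is Poisson with mean \<open>l * E t\<close>;
  averaging gives the mixture already computed.\<close>

lemma poisson_process_at_exponential:
  assumes N: "poisson_process M l N" and E: "exponential_process M b E"
    and ind: "prob_space.indep_set M (generated_events M {0..} N) (generated_events M {t} E)"
    and "0 < l" "0 < b" "0 \<le> t"
  shows "measure M {\<omega> \<in> space M. subordinated N E t \<omega> = n} =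
    (b / (b + l)) powr t * (l / (b + l)) ^ n * ((t + real n - 1) gchoose n)"
proof -
  have S: "subordinator M E"
    using E by (rule exponential_process_subordinator)
  interpret prob_space M
    using S by (rule subordinator_prob_space)
  let ?A = "generated_algebra M {0..} N" and ?B = "generated_algebra M {t} E"
  define H where "H = {x \<in> space (?A \<Otimes>\<^sub>M ?B). N (E t (snd x)) (fst x) = n}"
  have Et: "E t \<in> borel_measurable M"
    using S \<open>0 \<le> t\<close> by (rule subordinator_measurable)
  have nonneg: "0 \<le> E t \<omega>" if "\<omega> \<in> space M" for \<omega>
    using subordinator_nonneg[OF S that \<open>0 \<le> t\<close>] .
  have "(\<lambda>x. N (E t (snd x)) (fst x)) \<in> measurable (?A \<Otimes>\<^sub>M ?B) (count_space UNIV)"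
    by (rule poisson_process_random_time[OF N, where A = ?A])
      (auto intro!: measurable_generated_algebra measurable_compose[OF measurable_snd] nonneg simp: space_pair_measure)
  then have H: "H \<in> sets (?A \<Otimes>\<^sub>M ?B)"
    unfolding H_def by measurable
  have sets: "{\<omega> \<in> space M. N (E t \<omega>) \<omega> = n} \<in> events"
  proof -
    have [measurable]: "(\<lambda>\<omega>. N (E t \<omega>) \<omega>) \<in> measurable M (count_space UNIV)"
      by (rule poisson_process_random_time[OF N, where A = M])
        (auto intro: poisson_process_borel_measurable[OF N] Et nonneg)
    show ?thesis
      by measurable
  qed
  have law: "(\<integral>\<^sup>+ a. indicator H (a, b) \<partial>M) = ennreal (poisson_weight n (l * E t b))" if "b \<in> space M" for b
  proof -
    have [measurable]: "N (E t b) \<in> measurable M (count_space UNIV)"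
      using poisson_process_measurable[OF N nonneg[OF that]] .
    have "(\<integral>\<^sup>+ a. indicator H (a, b) \<partial>M) = (\<integral>\<^sup>+ a. indicator {a \<in> space M. N (E t b) a = n} a \<partial>M)"
      using that by (intro nn_integral_cong) (auto simp: H_def space_pair_measure split: split_indicator)
    then show ?thesis
      by (simp add: poisson_process_emeasure[OF N nonneg[OF that]])
  qed
  have "emeasure M {\<omega> \<in> space M. N (E t \<omega>) \<omega> = n} = (\<integral>\<^sup>+ \<omega>. indicator H (\<omega>, \<omega>) \<partial>M)"
    unfolding nn_integral_indicator[OF sets, symmetric]
    by (intro nn_integral_cong) (auto simp: H_def space_pair_measure split: split_indicator)
  \<comment> \<open>The coordinates are swapped so that the inner integral runs over Poisson paths
    at a fixed time.\<close>
  also have "\<dots> = (\<integral>\<^sup>+ \<omega>. indicator ((\<lambda>(b, a). (a, b)) -` H \<inter> space (?B \<Otimes>\<^sub>M ?A)) (\<omega>, \<omega>) \<partial>M)"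
    by (intro nn_integral_cong) (auto simp: space_pair_measure split: split_indicator)
  also have "\<dots> = (\<integral>\<^sup>+ b. \<integral>\<^sup>+ a. indicator ((\<lambda>(b, a). (a, b)) -` H \<inter> space (?B \<Otimes>\<^sub>M ?A)) (b, a) \<partial>M \<partial>M)"
  proof (rule nn_integral_independent)
    show "indep_set (generated_events M {t} E) (generated_events M {0..} N)"
      using indep_set_commute_prob[OF prob_space_axioms ind] .
    show "indicator ((\<lambda>(b, a). (a, b)) -` H \<inter> space (?B \<Otimes>\<^sub>M ?A)) \<in> borel_measurable (?B \<Otimes>\<^sub>M ?A)"
      by (intro borel_measurable_indicator measurable_sets[OF _ H] measurable_pair_swap')
  qed (rule prob_space_axioms)
  also have "\<dots> = (\<integral>\<^sup>+ b. \<integral>\<^sup>+ a. indicator H (a, b) \<partial>M \<partial>M)"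
    by (intro nn_integral_cong) (auto simp: space_pair_measure split: split_indicator)
  also have "\<dots> = (\<integral>\<^sup>+ b. ennreal (poisson_weight n (l * E t b)) \<partial>M)"
    by (intro nn_integral_cong law)
  also have "\<dots> = ennreal ((b / (b + l)) powr t * (l / (b + l)) ^ n * ((t + real n - 1) gchoose n))"
    using assms by (intro nn_integral_poisson_weight[OF E]) auto
  finally have "ennreal (prob {\<omega> \<in> space M. N (E t \<omega>) \<omega> = n}) = 
     ennreal ((b / (b + l)) powr t * (l / (b + l)) ^ n * ((t + real n - 1) gchoose n))"
    by (simp add: emeasure_eq_measure)
  moreover have "0 \<le> (t + real n - 1) gchoose n"
    using \<open>0 \<le> t\<close> by (rule gbinomial_add_nonneg)
  ultimately show ?thesis
    using assms by (simp add: subordinated_def)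
qed


section \<open>The law of the hitting time\<close>

text \<open>By monotonicity the visits to \<open>k\<close> form one block of consecutive indices,
  not starting at 0 since \<open>y 0 < k\<close>, so exactly one step enters it. Entering by index
  \<open>m\<close> means that this step starts before \<open>m\<close>.\<close>

lemma indicator_crossing:
  fixes y :: "nat \<Rightarrow> nat"
  assumes "mono y" "y 0 < k"
  shows "(of_bool (\<exists>n\<le>m. y n = k) :: ennreal) =
    (\<Sum>n. of_bool (n < m) * of_bool (y n < k \<and> y (Suc n) = k))"
proof (cases "\<exists>n\<le>m. y n = k")
  case True
  define q where "q = (LEAST n. y n = k)"
  have q: "y q = k"
    using True unfolding q_def by (auto intro: LeastI)
  have q_least: "q \<le> n" if "y n = k" for n
    using that unfolding q_def by (rule Least_le)
  have "q \<noteq> 0"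
    using q \<open>y 0 < k\<close> by (intro notI) simp
  then obtain p where p: "q = Suc p"
    using not0_implies_Suc by blast
  have "p < m"
    using True q_least p by force
  have "y p < k"
    using monoD[OF \<open>mono y\<close>, of p q] q q_least[of p] p by force
  have unique: "n = p" if "y n < k" "y (Suc n) = k" for n
  proof (rule antisym)
    show "p \<le> n"
      using q_least[OF that(2)] p by simp
    show "n \<le> p"
      using monoD[OF \<open>mono y\<close>, of q n] q that(1) p by (intro leI notI) simp
  qed
  have "(\<lambda>n. of_bool (n < m) * of_bool (y n < k \<and> y (Suc n) = k) :: ennreal) = (\<lambda>n. if n = p then 1 else 0)"
  proof
    fix n
    show "(of_bool (n < m) * of_bool (y n < k \<and> y (Suc n) = k) :: ennreal) = (if n = p then 1 else 0)"
    proof (cases "n = p")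
      case True
      then show ?thesis
        using q[unfolded p] \<open>p < m\<close> \<open>y p < k\<close> by simp
    next
      case False
      then have "\<not> (y n < k \<and> y (Suc n) = k)"
        using unique by blast
      then show ?thesis
        using False by simp
    qed
  qed
  moreover have "(\<Sum>n. if n = p then 1 else 0 :: ennreal) = 1"
    using sums_If_finite_set[of "{p}" "\<lambda>_. 1 :: ennreal"] by (simp add: sums_iff)
  ultimately show ?thesis
    using True by simp
next
  case False
  then have "(\<lambda>n. of_bool (n < m) * of_bool (y n < k \<and> y (Suc n) = k) :: ennreal) = (\<lambda>n. 0)"
    by (intro ext) (simp add: Suc_le_eq[symmetric])
  then show ?thesis
    using False by simp
qed

section \<open>Hitting time of the subordinated process\<close>

locale subordinated_poisson =
  fixes M :: "'a measure" and l1 l b :: real and k :: nat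
    and N1 N :: "real \<Rightarrow> 'a \<Rightarrow> nat" and E EN :: "real \<Rightarrow> 'a \<Rightarrow> real"
  assumes l1: "0 < l1" and l: "0 < l" and b: "0 < b" and k: "1 \<le> k"
    and N1: "poisson_process M l1 N1" and N: "poisson_process M l N" and E: "exponential_process M b E"
    and indep_N_E: "independent_processes M N E"
    and EN: "EN = subordinated E (\<lambda>t \<omega>. real (N t \<omega>))"
    and indep_N1_EN: "independent_processes M N1 EN"
begin

lemma subordinator_E: "subordinator M E"
  using E by (rule exponential_process_subordinator)

sublocale prob_space M
  using subordinator_E by (rule subordinator_prob_space)

abbreviation "X \<equiv> subordinated N1 EN"

lemma X_eq: "X t \<omega> = N1 (E (real (N t \<omega>)) \<omega>) \<omega>"
  by (simp add: subordinated_def EN)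

lemma E_nonneg: "\<omega> \<in> space M \<Longrightarrow> 0 \<le> E (real n) \<omega>"
  using subordinator_nonneg[OF subordinator_E] by simp

lemma EN_nonneg: "\<omega> \<in> space M \<Longrightarrow> 0 \<le> EN t \<omega>"
  by (simp add: EN subordinated_def E_nonneg)

lemma measurable_EN: "0 \<le> t \<Longrightarrow> EN t \<in> borel_measurable M"
  unfolding EN subordinated_def
  by (rule measurable_compose_countable[OF subordinator_measurable[OF subordinator_E] 
        poisson_process_measurable[OF N]]) auto

lemma measurable_X: "0 \<le> t \<Longrightarrow> X t \<in> measurable M (count_space UNIV)"
  unfolding subordinated_def
  by (rule poisson_process_random_time[OF N1, where A = M])
    (auto intro: poisson_process_borel_measurable[OF N1] measurable_EN EN_nonneg)

text \<open>Time enters \<open>X\<close> only through \<open>N\<close>, so \<open>X\<close> inherits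
  the local constancy of \<open>N\<close>.\<close>

lemma eventually_X_eq:
  assumes "\<omega> \<in> space M" "0 \<le> u"
  shows "\<forall>\<^sub>F s in at_right u. X s \<omega> = X u \<omega>"
  using eventually_eq_right_of_nat[OF subordinator_right_continuous[OF poisson_process_subordinator[OF N] assms]]
  by eventually_elim (simp add: X_eq)

definition hit :: "real \<Rightarrow> 'a set" where
  "hit t = {\<omega> \<in> space M. \<exists>u\<in>grid t. X u \<omega> = k}"

lemma hit_iff: "0 \<le> t \<Longrightarrow> hit t = {\<omega> \<in> space M. hitting_time X k \<omega> \<le> ereal t}"
  unfolding hit_def by (intro Collect_cong conj_cong refl hitting_time_le_iff[symmetric] eventually_X_eq)

lemma sets_hit [measurable]:
  assumes "0 \<le> t"
  shows "hit t \<in> events"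
proof -
  have "hit t = (\<Union>u\<in>grid t. {\<omega> \<in> space M. X u \<omega> = k})"
    by (auto simp: hit_def)
  moreover have "{\<omega> \<in> space M. X u \<omega> = k} \<in> events" if "u \<in> grid t" for u
  proof -
    note [measurable] = measurable_X[OF grid_subset(1)[OF assms that]]
    show ?thesis by measurable
  qed
  ultimately show ?thesis
    by (auto intro!: sets.countable_UN')
qed

lemma measurable_hitting_time: "hitting_time X k \<in> borel_measurable M"
proof (rule borel_measurableI_le)
  fix y :: ereal
  show "{\<omega> \<in> space M. hitting_time X k \<omega> \<le> y} \<in> events"
  proof (cases y)
    case (real r)
    show ?thesis
    proof (cases "0 \<le> r")
      case True
      then show ?thesis
        using sets_hit[OF True] by (simp add: hit_iff real)
    next
      case False
      then have "{\<omega> \<in> space M. hitting_time X k \<omega> \<le> y} = {}"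
        using less_le_trans[OF _ hitting_time_nonneg, of "ereal r" X k] real by (auto simp: not_le)
      then show ?thesis
        by (simp only: sets.empty_sets)
    qed
  next
    case MInf
    then have "{\<omega> \<in> space M. hitting_time X k \<omega> \<le> y} = {}"
      using hitting_time_nonneg[of X k] by (auto simp: le_less)
    then show ?thesis
      by (simp only: sets.empty_sets)
  qed simp
qed

text \<open>The first coordinate supplies the path of \<open>N1\<close>, the second that of
  \<open>E\<close>; they appear as independent copies once both decouplings are done.\<close>

definition crossing :: "nat \<Rightarrow> ('a \<times> 'a) set" where
  "crossing n = {(\<omega>, \<omega>') \<in> space M \<times> space M. N1 (E (real n) \<omega>') \<omega> < k \<and> N1 (E (real (Suc n)) \<omega>') \<omega> = k}"

lemma sets_crossing [measurable]: "crossing n \<in> sets (M \<Otimes>\<^sub>M M)"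
proof -
  have [measurable]: "(\<lambda>x. N1 (E (real n) (snd x)) (fst x)) \<in> measurable (M \<Otimes>\<^sub>M M) (count_space UNIV)" for n
    by (rule poisson_process_random_time[OF N1, where A = M])
      (auto intro!: poisson_process_borel_measurable[OF N1] E_nonneg subordinator_measurable[OF subordinator_E]
        measurable_compose[OF measurable_snd] simp: space_pair_measure)
  have "crossing n = {x \<in> space (M \<Otimes>\<^sub>M M). N1 (E (real n) (snd x)) (fst x) < k \<and>
      N1 (E (real (Suc n)) (snd x)) (fst x) = k}"
    by (auto simp: crossing_def space_pair_measure)
  also have "\<dots> \<in> sets (M \<Otimes>\<^sub>M M)"
    by measurable
  finally show ?thesis .
qed

text \<open>Slicing at a fixed path of \<open>E\<close> uses the increments of \<open>N1\<close>,
  whereas the decoupling yields slices at a fixed path of \<open>N1\<close>; Tonelli reconciles the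
  two orders.\<close>

lemma emeasure_crossing:
  "emeasure (M \<Otimes>\<^sub>M M) (crossing n) =
    ennreal (b / (l1 + b) * ((l1 / (l1 + b)) powr real k * (b / (l1 + b)) ^ n * ((real k + real n - 1) gchoose n)))"
proof -
  interpret pair_sigma_finite M M ..
  have "emeasure (M \<Otimes>\<^sub>M M) (crossing n) = (\<integral>\<^sup>+ \<omega>'. emeasure M ((\<lambda>\<omega>. (\<omega>, \<omega>')) -` crossing n) \<partial>M)"
    by (rule emeasure_pair_measure_alt2) simp
  also have "\<dots> = (\<integral>\<^sup>+ \<omega>'. emeasure M {\<omega> \<in> space M. N1 (E (real n) \<omega>') \<omega> < k \<and> N1 (E (real (Suc n)) \<omega>') \<omega> = k} \<partial>M)"
    by (intro nn_integral_cong arg_cong[where f = "emeasure M"]) (auto simp: crossing_def)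
  finally show ?thesis
    using nn_integral_crossing[OF N1 E b l1 k] by simp
qed

text \<open>With the path \<open>\<omega>\<close> of \<open>N1\<close> frozen, \<open>N\<close> and \<open>E\<close> may be taken from independent copies; the
  path of \<open>N\<close> then matters only through \<open>N t\<close>, as \<open>N\<close> almost surely visits every \<open>n \<le> N t\<close>.\<close>
lemma nn_integral_hit_fixed_path:
  assumes t: "0 \<le> t" and \<omega>: "\<omega> \<in> space M"
  shows "(\<integral>\<^sup>+ \<omega>'. of_bool (\<exists>u\<in>grid t. N1 (EN u \<omega>') \<omega> = k) \<partial>M) =
    (\<Sum>n. ennreal (erlang_CDF n l t) * emeasure M (Pair \<omega> -` crossing n))"
proof -
  let ?P = "generated_algebra M {0..} N \<Otimes>\<^sub>M generated_algebra M {0..} E"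
  define h where "h x = (of_bool (\<exists>u\<in>grid t. N1 (E (real (N u (fst x))) (snd x)) \<omega> = k) :: ennreal)" for x
  have meas: "(\<lambda>x. N1 (E (real (N u (fst x))) (snd x)) \<omega>) \<in> measurable ?P (count_space UNIV)" if "0 \<le> u" for u
  \<comment> \<open>\<open>N u\<close> has countably many values, so measurability of
    \<open>E\<close> at each integer time suffices.\<close>
  proof (rule measurable_compose_countable[where g = "\<lambda>x. N u (fst x)"])
    show "(\<lambda>x. N1 (E (real n) (snd x)) \<omega>) \<in> measurable ?P (count_space UNIV)" for n
      using \<omega> by (intro poisson_process_random_time[OF N1, where A = M])
        (auto intro!: poisson_process_borel_measurable[OF N1] E_nonneg measurable_generated_algebra
          measurable_compose[OF measurable_snd] simp: space_pair_measure)
    have "N u \<in> measurable (generated_algebra M {0..} N) (count_space UNIV)"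
      using measurable_generated_algebra[of u "{0..}" N M] that
      by (simp add: measurable_def sets_borel_eq_count_space)
    then show "(\<lambda>x. N u (fst x)) \<in> measurable ?P (count_space UNIV)"
      by (rule measurable_compose[OF measurable_fst])
  qed
  have h: "h \<in> borel_measurable ?P"
  proof -
    have "{x \<in> space ?P. N1 (E (real (N u (fst x))) (snd x)) \<omega> = k} \<in> sets ?P" if "u \<in> grid t" for u
      using measurable_sets[OF meas[OF grid_subset(1)[OF t that]], of "{k}"] by (simp add: vimage_def Int_def conj_commute)
    then have "(\<Union>u\<in>grid t. {x \<in> space ?P. N1 (E (real (N u (fst x))) (snd x)) \<omega> = k}) \<in> sets ?P" (is "?H \<in> _")
      by (intro sets.countable_UN') auto
    then have "indicator ?H \<in> borel_measurable ?P"
      by (rule borel_measurable_indicator)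
    then show ?thesis
      by (rule measurable_cong[THEN iffD1, rotated]) (auto simp: h_def split: split_indicator)
  qed
  let ?I = "\<lambda>n \<omega>'. indicator (Pair \<omega> -` crossing n) \<omega>' :: ennreal"
  have sec: "Pair \<omega> -` crossing n \<in> events" for n
    by (rule sets_Pair1[OF sets_crossing])
  have AE: "AE c in M. (\<integral>\<^sup>+ \<omega>'. h (c, \<omega>') \<partial>M) =
      (\<Sum>n. of_bool (n < N t c) * emeasure M (Pair \<omega> -` crossing n))"
    using AE_poisson_process_unit_jumps[OF N l t] AE_space
  proof eventually_elim
    case (elim c)
    then obtain m where m: "0 < m"
      "\<And>i. i < m \<Longrightarrow> N (t * real (Suc i) / real m) c \<le> N (t * real i / real m) c + 1"
      by blast
    have c: "c \<in> space M"
      using elim by simp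
    have "(\<lambda>u. N u c) ` grid t = {..N t c}"
      using subordinator_zero[OF poisson_process_subordinator[OF N] c] poisson_process_mono[OF N c]
      by (intro image_grid_unit_jumps[OF t _ _ m]) auto
    then have visits: "(\<exists>u\<in>grid t. P (N u c)) \<longleftrightarrow> (\<exists>n\<le>N t c. P n)" for P
      by (metis (no_types, lifting) atMost_iff image_iff)
    \<comment> \<open>The exceptional null set concerns \<open>c\<close> alone, so this holds for
      every \<omega>'.\<close>
    have "h (c, \<omega>') = (\<Sum>n. of_bool (n < N t c) * ?I n \<omega>')" if \<omega>': "\<omega>' \<in> space M" for \<omega>'
    proof -
      let ?y = "\<lambda>n. N1 (E (real n) \<omega>') \<omega>"
      have "mono ?y"
        using subordinator_mono[OF subordinator_E \<omega>'] E_nonneg[OF \<omega>']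
        by (intro monoI poisson_process_mono[OF N1 \<omega>]) auto
      moreover have "?y 0 < k"
        using subordinator_zero[OF subordinator_E \<omega>'] k
          subordinator_zero[OF poisson_process_subordinator[OF N1] \<omega>] by simp
      ultimately have "of_bool (\<exists>n\<le>N t c. ?y n = k) =
          (\<Sum>n. of_bool (n < N t c) * of_bool (?y n < k \<and> ?y (Suc n) = k) :: ennreal)"
        by (rule indicator_crossing)
      moreover have "of_bool (?y n < k \<and> ?y (Suc n) = k) = ?I n \<omega>'" for n
        using \<omega> \<omega>' by (auto simp: crossing_def split: split_indicator)
      ultimately show ?thesis
        unfolding h_def fst_conv snd_conv visits[of "\<lambda>n. ?y n = k"] by simp
    qed
    then have "(\<integral>\<^sup>+ \<omega>'. h (c, \<omega>') \<partial>M) = (\<integral>\<^sup>+ \<omega>'. (\<Sum>n. of_bool (n < N t c) * ?I n \<omega>') \<partial>M)"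
      by (intro nn_integral_cong)
    also have "\<dots> = (\<Sum>n. \<integral>\<^sup>+ \<omega>'. of_bool (n < N t c) * ?I n \<omega>' \<partial>M)"
      by (intro nn_integral_suminf borel_measurable_times_ennreal borel_measurable_const borel_measurable_indicator sec)
    also have "\<dots> = (\<Sum>n. of_bool (n < N t c) * emeasure M (Pair \<omega> -` crossing n))"
      by (simp only: nn_integral_cmult borel_measurable_indicator nn_integral_indicator sec)
    finally show ?case .
  qed
  have "(\<integral>\<^sup>+ \<omega>'. of_bool (\<exists>u\<in>grid t. N1 (EN u \<omega>') \<omega> = k) \<partial>M) = (\<integral>\<^sup>+ \<omega>'. h (\<omega>', \<omega>') \<partial>M)"
    by (simp add: h_def EN subordinated_def)
  also have "\<dots> = (\<integral>\<^sup>+ c. \<integral>\<^sup>+ \<omega>'. h (c, \<omega>') \<partial>M \<partial>M)"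
    using prob_space_axioms indep_N_E h unfolding independent_processes_def by (rule nn_integral_independent)
  also have "\<dots> = (\<integral>\<^sup>+ c. (\<Sum>n. of_bool (n < N t c) * emeasure M (Pair \<omega> -` crossing n)) \<partial>M)"
    using AE by (rule nn_integral_cong_AE)
  also have "\<dots> = (\<Sum>n. \<integral>\<^sup>+ c. indicator {c \<in> space M. n < N t c} c * emeasure M (Pair \<omega> -` crossing n) \<partial>M)"
  proof -
    note [measurable] = poisson_process_measurable[OF N t]
    have "(\<integral>\<^sup>+ c. (\<Sum>n. of_bool (n < N t c) * emeasure M (Pair \<omega> -` crossing n)) \<partial>M) =
        (\<integral>\<^sup>+ c. (\<Sum>n. indicator {c \<in> space M. n < N t c} c * emeasure M (Pair \<omega> -` crossing n)) \<partial>M)"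
      by (intro nn_integral_cong suminf_cong) (auto split: split_indicator)
    then show ?thesis
      by (simp add: nn_integral_suminf)
  qed
  also have "\<dots> = (\<Sum>n. ennreal (erlang_CDF n l t) * emeasure M (Pair \<omega> -` crossing n))"
  proof (rule suminf_cong)
    fix n
    note [measurable] = poisson_process_measurable[OF N t]
    show "(\<integral>\<^sup>+ c. indicator {c \<in> space M. n < N t c} c * emeasure M (Pair \<omega> -` crossing n) \<partial>M) =
        ennreal (erlang_CDF n l t) * emeasure M (Pair \<omega> -` crossing n)"
      using poisson_process_tail[OF N t] by (simp add: nn_integral_multc emeasure_eq_measure)
  qed
  finally show ?thesis .
qed

lemma emeasure_hit:
  assumes t: "0 \<le> t"
  shows "emeasure M (hit t) = (\<Sum>n. ennreal (erlang_CDF n l t) * emeasure (M \<Otimes>\<^sub>M M) (crossing n))"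
proof -
  let ?P = "generated_algebra M {0..} N1 \<Otimes>\<^sub>M generated_algebra M {0..} EN"
  define h where "h x = (of_bool (\<exists>u\<in>grid t. N1 (EN u (snd x)) (fst x) = k) :: ennreal)" for x
  have meas: "(\<lambda>x. N1 (EN u (snd x)) (fst x)) \<in> measurable ?P (count_space UNIV)" if "0 \<le> u" for u
    using that by (intro poisson_process_random_time[OF N1, where A = "generated_algebra M {0..} N1"])
      (auto intro!: measurable_generated_algebra measurable_compose[OF measurable_snd] EN_nonneg simp: space_pair_measure)
  have h: "h \<in> borel_measurable ?P"
  proof -
    have "{x \<in> space ?P. N1 (EN u (snd x)) (fst x) = k} \<in> sets ?P" if "u \<in> grid t" for u
      using measurable_sets[OF meas[OF grid_subset(1)[OF t that]], of "{k}"] by (simp add: vimage_def Int_def conj_commute)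
    then have "(\<Union>u\<in>grid t. {x \<in> space ?P. N1 (EN u (snd x)) (fst x) = k}) \<in> sets ?P" (is "?H \<in> _")
      by (intro sets.countable_UN') auto
    then have "indicator ?H \<in> borel_measurable ?P"
      by (rule borel_measurable_indicator)
    then show ?thesis
      by (rule measurable_cong[THEN iffD1, rotated]) (auto simp: h_def split: split_indicator)
  qed
  have "emeasure M (hit t) = (\<integral>\<^sup>+ \<omega>. h (\<omega>, \<omega>) \<partial>M)"
    unfolding nn_integral_indicator[OF sets_hit[OF t], symmetric]
    by (intro nn_integral_cong) (auto simp: h_def hit_def subordinated_def split: split_indicator)
  also have "\<dots> = (\<integral>\<^sup>+ \<omega>. \<integral>\<^sup>+ \<omega>'. h (\<omega>, \<omega>') \<partial>M \<partial>M)"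
    using prob_space_axioms indep_N1_EN h unfolding independent_processes_def by (rule nn_integral_independent)
  also have "\<dots> = (\<integral>\<^sup>+ \<omega>. (\<Sum>n. ennreal (erlang_CDF n l t) * emeasure M (Pair \<omega> -` crossing n)) \<partial>M)"
    unfolding h_def fst_conv snd_conv by (intro nn_integral_cong nn_integral_hit_fixed_path t)
  also have "\<dots> = (\<Sum>n. ennreal (erlang_CDF n l t) * (\<integral>\<^sup>+ \<omega>. emeasure M (Pair \<omega> -` crossing n) \<partial>M))"
  proof -
    have [measurable]: "(\<lambda>\<omega>. emeasure M (Pair \<omega> -` crossing n)) \<in> borel_measurable M" for n
      by (rule measurable_emeasure_Pair) simp
    show ?thesis
      by (simp add: nn_integral_suminf nn_integral_cmult)
  qed
  also have "\<dots> = (\<Sum>n. ennreal (erlang_CDF n l t) * emeasure (M \<Otimes>\<^sub>M M) (crossing n))"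
    by (simp add: emeasure_pair_measure_alt)
  finally show ?thesis .
qed

text \<open>Finite measures on the line are determined by the half-lines \<open>{..t}\<close>. There
  the two sides agree, because integrating each Erlang density up to \<open>t\<close> gives the
  Erlang distribution function of \<open>emeasure_hit\<close>.\<close>

lemma emeasure_hitting_time:
  assumes A: "A \<in> sets borel"
  shows "emeasure M {\<omega> \<in> space M. hitting_time X k \<omega> \<in> ereal ` A} =
    (\<integral>\<^sup>+ s\<in>A. (\<Sum>n. ennreal (erlang_density n l s) * emeasure (M \<Otimes>\<^sub>M M) (crossing n)) \<partial>lborel)"
proof -
  let ?T = "hitting_time X k"
  define g where "g s = (\<Sum>n. ennreal (erlang_density n l s) * emeasure (M \<Otimes>\<^sub>M M) (crossing n))" for s
  \<comment> \<open>\<open>real_of_ereal\<close> sends infinity to 0, so paths that never hit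
    \<open>k\<close> are removed before passing to the reals.\<close>
  define F where "F = {\<omega> \<in> space M. ?T \<omega> < \<infinity>}"
  define \<mu> where "\<mu> = distr (restrict_space M F) borel (\<lambda>\<omega>. real_of_ereal (?T \<omega>))"
  have [measurable]: "?T \<in> borel_measurable M"
    by (rule measurable_hitting_time)
  have [measurable]: "g \<in> borel_measurable borel"
    unfolding g_def by measurable
  have F: "F \<in> events"
    unfolding F_def by measurable
  have \<mu>: "emeasure \<mu> B = emeasure M {\<omega> \<in> space M. ?T \<omega> \<in> ereal ` B}" if B: "B \<in> sets borel" for B
  proof -
    have eq: "(\<lambda>\<omega>. real_of_ereal (?T \<omega>)) -` B \<inter> F = {\<omega> \<in> space M. ?T \<omega> \<in> ereal ` B}"
    proof (intro set_eqI iffI)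
      fix \<omega> assume *: "\<omega> \<in> (\<lambda>\<omega>. real_of_ereal (?T \<omega>)) -` B \<inter> F"
      then have "?T \<omega> = ereal (real_of_ereal (?T \<omega>))"
        using hitting_time_nonneg[of X k \<omega>] by (cases "?T \<omega>") (auto simp: F_def)
      then show "\<omega> \<in> {\<omega> \<in> space M. ?T \<omega> \<in> ereal ` B}"
        using * by (auto simp: F_def)
    qed (auto simp: F_def)
    have "emeasure \<mu> B = emeasure (restrict_space M F) ((\<lambda>\<omega>. real_of_ereal (?T \<omega>)) -` B \<inter> space (restrict_space M F))"
      unfolding \<mu>_def by (rule emeasure_distr) (use B in \<open>auto intro!: measurable_restrict_space1\<close>)
    also have "\<dots> = emeasure M {\<omega> \<in> space M. ?T \<omega> \<in> ereal ` B}"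
      using F by (simp add: space_restrict_space emeasure_restrict_space eq[symmetric] Int_absorb1 F_def)
    finally show ?thesis .
  qed
  have "\<mu> = density lborel g"
  proof (rule measure_eqI_generator_eq[where E = "range atMost" and \<Omega> = UNIV and A = "\<lambda>i. {..real i}"])
    show "Int_stable (range atMost :: real set set)"
      by (auto simp: Int_stable_def)
    show "sets \<mu> = sigma_sets UNIV (range atMost)" "sets (density lborel g) = sigma_sets UNIV (range atMost)"
      by (simp_all add: \<mu>_def borel_eq_atMost)
    show "(\<Union>i. {..real i}) = UNIV"
      by (auto intro: real_arch_simple)
    show "emeasure \<mu> {..real i} \<noteq> \<infinity>" for i
      by (simp add: \<mu>)
    fix B assume "B \<in> range (atMost :: real \<Rightarrow> _)"
    then obtain t where B: "B = {..t}"
      by blast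
    have "emeasure (density lborel g) {..t} = (\<Sum>n. \<integral>\<^sup>+ s. ennreal (erlang_density n l s) * indicator {..t} s * emeasure (M \<Otimes>\<^sub>M M) (crossing n) \<partial>lborel)"
    proof -
      have "emeasure (density lborel g) {..t} = (\<integral>\<^sup>+ s. (\<Sum>n. ennreal (erlang_density n l s) * indicator {..t} s * emeasure (M \<Otimes>\<^sub>M M) (crossing n)) \<partial>lborel)"
        by (simp add: emeasure_density) (simp add: g_def mult_ac flip: ennreal_suminf_cmult)
      then show ?thesis
        by (simp add: nn_integral_suminf)
    qed
    also have "\<dots> = (\<Sum>n. ennreal (erlang_CDF n l t) * emeasure (M \<Otimes>\<^sub>M M) (crossing n))"
      using l by (simp add: nn_integral_multc nn_integral_erlang_density)
    also have "\<dots> = emeasure \<mu> {..t}"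
    proof (cases "0 \<le> t")
      case True
      have "{\<omega> \<in> space M. ?T \<omega> \<in> ereal ` {..t}} = {\<omega> \<in> space M. ?T \<omega> \<le> ereal t}"
      proof -
        have "?T \<omega> \<in> ereal ` {..t} \<longleftrightarrow> ?T \<omega> \<le> ereal t" for \<omega>
          using hitting_time_nonneg[of X k \<omega>] by (cases "?T \<omega>") auto
        then show ?thesis by simp
      qed
      then show ?thesis
        using emeasure_hit[OF True] by (simp add: \<mu> hit_iff[OF True])
    next
      case False
      have "?T \<omega> \<notin> ereal ` {..t}" for \<omega>
        using False hitting_time_nonneg[of X k \<omega>] by auto
      then show ?thesis
        using False by (simp add: \<mu> erlang_CDF_def)
    qed
    finally show "emeasure \<mu> B = emeasure (density lborel g) B"
      by (simp add: B)
  qed auto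
  then show ?thesis
    using \<mu>[OF A] A by (simp add: emeasure_density g_def[symmetric])
qed

end

theorem lemma1:
  fixes M :: "'a measure" and M' :: "'b measure" and M'' :: "'c measure"
    and lam1 lam beta :: real and k :: nat
    and N1 N :: "real \<Rightarrow> 'a \<Rightarrow> nat" and E EN :: "real \<Rightarrow> 'a \<Rightarrow> real"
    and N_lam :: "real \<Rightarrow> 'b \<Rightarrow> nat"
    and N_beta :: "real \<Rightarrow> 'c \<Rightarrow> nat" and E1 :: "real \<Rightarrow> 'c \<Rightarrow> real"
  assumes "lam1 > 0" and "lam > 0" and "beta > 0" and "k \<ge> 1"
    and "poisson_process M lam1 N1"
    and "poisson_process M lam N"
    and "exponential_process M beta E"
    and "independent_processes M N E"
    and "EN = subordinated E (\<lambda>t \<omega>. real (N t \<omega>))"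
    and "independent_processes M N1 EN"
    and "poisson_process M' lam N_lam"
    and "poisson_process M'' beta N_beta"
    and "exponential_process M'' lam1 E1"
    and "prob_space.indep_set M''
           (generated_events M'' {0..} N_beta) (generated_events M'' {real k} E1)"
  shows "hitting_time (subordinated N1 EN) k \<in> borel_measurable M \<and>
    (\<forall>A \<in> sets borel. A \<subseteq> {0<..} \<longrightarrow>
       emeasure M {\<omega> \<in> space M. hitting_time (subordinated N1 EN) k \<omega> \<in> ereal ` A} =
       (\<integral>\<^sup>+ s \<in> A. ennreal (lam * beta / (lam1 + beta) *
          (\<Sum>n. measure M' {\<omega> \<in> space M'. N_lam s \<omega> = n} *
               measure M'' {\<omega> \<in> space M''. subordinated N_beta E1 (real k) \<omega> = n})) \<partial>lborel))"
proof -
  interpret subordinated_poisson M lam1 lam beta k N1 N E EN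
    using assms by unfold_locales
  define c where "c n = measure M'' {\<omega> \<in> space M''. subordinated N_beta E1 (real k) \<omega> = n}" for n
  have "prob_space M''"
    using subordinator_prob_space[OF exponential_process_subordinator[OF assms(13)]] .
  then have c: "0 \<le> c n" "c n \<le> 1" for n
    by (auto simp: c_def prob_space.prob_le_1)
  \<comment> \<open>The rates are exchanged here: the Poisson rate is \<open>beta\<close> and the
    exponential parameter is \<open>lam1\<close>.\<close>
  have cross: "emeasure (M \<Otimes>\<^sub>M M) (crossing n) = ennreal (beta / (lam1 + beta) * c n)" for n
    unfolding emeasure_crossing c_def
    using poisson_process_at_exponential[OF assms(12-14)] assms by simp
  have density: "(\<Sum>n. ennreal (erlang_density n lam s) * emeasure (M \<Otimes>\<^sub>M M) (crossing n)) =
      ennreal (lam * beta / (lam1 + beta) * (\<Sum>n. measure M' {\<omega> \<in> space M'. N_lam s \<omega> = n} * c n))"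
    if "0 < s" for s
  proof -
    let ?w = "\<lambda>n. poisson_weight n (lam * s)"
    have w: "0 \<le> ?w n" for n
      using that assms by simp
    \<comment> \<open>The series in the theorem is real-valued, so convergence has to be shown
      before it can be identified with the \<open>ennreal\<close> sum.\<close>
    have "summable ?w"
      using poisson_weight_sums[of "lam * s" 1] by (simp add: sums_iff)
    then have sm: "summable (\<lambda>n. ?w n * c n)"
      by (rule summable_comparison_test'[of _ 0]) (use w c in \<open>auto simp: abs_mult intro: mult_left_le\<close>)
    have "(\<Sum>n. ennreal (erlang_density n lam s) * emeasure (M \<Otimes>\<^sub>M M) (crossing n)) =
        (\<Sum>n. ennreal (lam * beta / (lam1 + beta) * (?w n * c n)))"
    proof (rule suminf_cong)
      fix n
      \<comment> \<open>The factor \<open>lam\<close> of the theorem is the ratio of the Erlang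
        density to the Poisson weight of the same index.\<close>
      have "erlang_density n lam s * (beta / (lam1 + beta) * c n) = lam * beta / (lam1 + beta) * (?w n * c n)"
        using that by (simp add: erlang_density_def poisson_weight_def power_mult_distrib mult_ac)
      then show "ennreal (erlang_density n lam s) * emeasure (M \<Otimes>\<^sub>M M) (crossing n) =
          ennreal (lam * beta / (lam1 + beta) * (?w n * c n))"
        unfolding cross using assms(1,3) c by (metis ennreal_mult'' mult_nonneg_nonneg divide_nonneg_pos add_pos_pos less_imp_le)
    qed
    also have "\<dots> = ennreal (\<Sum>n. lam * beta / (lam1 + beta) * (?w n * c n))"
      using w c assms sm by (intro suminf_ennreal2 summable_mult mult_nonneg_nonneg) auto
    also have "\<dots> = ennreal (lam * beta / (lam1 + beta) * (\<Sum>n. ?w n * c n))"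
      using sm by (subst suminf_mult) auto
    finally show ?thesis
      using that by (simp add: poisson_process_law[OF assms(11)])
  qed
  have "emeasure M {\<omega> \<in> space M. hitting_time (subordinated N1 EN) k \<omega> \<in> ereal ` A} =
       (\<integral>\<^sup>+ s \<in> A. ennreal (lam * beta / (lam1 + beta) *
          (\<Sum>n. measure M' {\<omega> \<in> space M'. N_lam s \<omega> = n} * c n)) \<partial>lborel)"
    if "A \<in> sets borel" "A \<subseteq> {0<..}" for A
    unfolding emeasure_hitting_time[OF that(1)]
    using density that(2) by (intro nn_integral_cong) (auto split: split_indicator)
  then show ?thesis
    using measurable_hitting_time unfolding c_def by blast
qed

end
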